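(* Let $t\ge 3$ be an integer and let $\gamma=-\Gamma'(1)$ be the Euler–Mascheroni constant. Let $\mathbf X_1,\dots,\mathbf X_n$ be independent, uniformly distributed points in $[0,1]^t$, partially ordered componentwise. For a positive integer $\ell$, let $C_\ell$ denote the number of maximal chains of length $\ell$ (as defined in the context), and write $\ell=x\,n^{1/t}$ with $x\le e$. (i) For $x>0$, $a>\gamma t$ and $b>0$ define \[ q(x;a,b)=\max\left\{\min_{u\in(0,1)}\frac{\Gamma^t(1-u)}{e^{au}};\ \frac{1+b}{e^{b}};\ \exp\!\left(-\frac{e^{-a}}{x^t(1+b)^t}\right)\right\}. \] Then $q(x;a,b)<1$, and $q(x)=\min_{a,b}q(x;a,b)$ is attained at a unique point $(a(x),b(x))$, which satisfies \[ \min_{u\in(0,1)}\frac{\Gamma^t(1-u)}{e^{a(x)u}}=\frac{1+b(x)}{e^{b(x)}}=\exp\!\left(-\frac{e^{-a(x)}}{x^t(1+b(x))^t}\right). \] (ii) Define $\bar x=\inf\bigl\{x\in[e^{-\gamma},e]:\ (e/x)^t q(x)<1\bigr\}$. Then $\bar x<e$, and for every $\varepsilon>0$, if $\ell=(\bar x+\varepsilon)n^{1/t}$, then \[ \mathbb E[C_\ell]=O\bigl[\exp(-\Theta(\varepsilon)\,n^{1/t})\bigr]\quad (n\to\infty). \] Consequently, the length of the longest chain in $\{\mathbf X_1,\dots,\mathbf X_n\}$ is below $(\bar x+\varepsilon)n^{1/t}$ with probability at least $1-O\bigl[\exp(-\Theta(\varepsilon)n^{1/t})\bigr]$.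
   Context: For $\mathbf x',\mathbf x''\in\mathbb R^t$, write $\mathbf x''\ge\mathbf x'$ if every component of $\mathbf x''$ is at least the corresponding component of $\mathbf x'$. A chain of length $\ell$ in the random set $\{\mathbf X_1,\dots,\mathbf X_n\}$ is a sequence of distinct points $\mathbf X_{i_1}\le\mathbf X_{i_2}\le\cdots\le\mathbf X_{i_\ell}$; set $\mathbf X_{i_0}:=\vec{\mathbf 0}=(0,\dots,0)$. The chain has $\ell$ associated intervals $[\mathbf X_{i_{k-1}},\mathbf X_{i_k}]$, $k=1,\dots,\ell$, where the interval $[\mathbf X_{i_{k-1}},\mathbf X_{i_k}]$ consists of the points $\mathbf X_j$, $j\notin\{i_1,\dots,i_\ell\}$, with $\mathbf X_{i_{k-1}}\le \mathbf X_j\le\mathbf X_{i_k}$ (strictly between them). The chain is called maximal if all $\ell$ of these intervals are empty. The longest chain is the chain of largest length. Here $\Theta(\varepsilon)$ denotes a quantity bounded between two positive constants depending on $\varepsilon$ (and $t$), and the $O$ refers to $n\to\infty$. *)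

theory Defs
  imports "HOL-Probability.Probability" "HOL-Library.Landau_Symbols"
begin

text \<open>
  Points live in \<open>real ^ 't\<close>, so \<open>t = CARD('t)\<close>, and \<open>\<le>\<close> on this type is the componentwise
  partial order of the library. The sample is \<open>x 1, \<dots>, x n\<close>.
\<close>

definition iid_uniform_cube :: "'a measure \<Rightarrow> (nat \<Rightarrow> 'a \<Rightarrow> real ^ 't::finite) \<Rightarrow> nat \<Rightarrow> bool" where
  "iid_uniform_cube M X n \<longleftrightarrow>
     prob_space M \<and>
     prob_space.indep_vars M (\<lambda>_. borel) X {1..n} \<and>
     (\<forall>i\<in>{1..n}. distr M borel (X i) = uniform_measure lborel (cbox 0 1))"

text \<open>
  A chain is given by its list \<open>[i\<^sub>1, \<dots>, i\<^sub>\<ell>]\<close> of indices. Counting index lists and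
  counting sequences of points agree whenever \<open>x 1, \<dots>, x n\<close> are distinct, hence almost surely.
\<close>

definition is_chain :: "(nat \<Rightarrow> real ^ 't::finite) \<Rightarrow> nat \<Rightarrow> nat list \<Rightarrow> bool" where
  "is_chain x n is \<longleftrightarrow>
     set is \<subseteq> {1..n} \<and> distinct (map x is) \<and> sorted_wrt (\<le>) (map x is)"

definition chain_point :: "(nat \<Rightarrow> real ^ 't::finite) \<Rightarrow> nat list \<Rightarrow> nat \<Rightarrow> real ^ 't" where
  "chain_point x is k = (if k = 0 then 0 else x (is ! (k - 1)))"

definition chain_interval ::
    "(nat \<Rightarrow> real ^ 't::finite) \<Rightarrow> nat \<Rightarrow> nat list \<Rightarrow> nat \<Rightarrow> (real ^ 't) set" where
  "chain_interval x n is k =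
     {x j | j. j \<in> {1..n} \<and> j \<notin> set is \<and>
        chain_point x is (k - 1) \<le> x j \<and> x j \<le> chain_point x is k \<and>
        x j \<noteq> chain_point x is (k - 1) \<and> x j \<noteq> chain_point x is k}"

definition is_maximal_chain :: "(nat \<Rightarrow> real ^ 't::finite) \<Rightarrow> nat \<Rightarrow> nat list \<Rightarrow> bool" where
  "is_maximal_chain x n is \<longleftrightarrow>
     is_chain x n is \<and> (\<forall>k\<in>{1..length is}. chain_interval x n is k = {})"

definition num_maximal_chains :: "(nat \<Rightarrow> real ^ 't::finite) \<Rightarrow> nat \<Rightarrow> nat \<Rightarrow> nat" where
  "num_maximal_chains x n l = card {is. is_maximal_chain x n is \<and> length is = l}"

definition longest_chain_length :: "(nat \<Rightarrow> real ^ 't::finite) \<Rightarrow> nat \<Rightarrow> nat" where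
  "longest_chain_length x n = Max (length ` {is. is_chain x n is})"

text \<open>
  Minima over infinite sets are written as infima; that they are attained is part of the theorem.
\<close>

definition gamma_quot :: "nat \<Rightarrow> real \<Rightarrow> real \<Rightarrow> real" where
  "gamma_quot t a u = Gamma (1 - u) ^ t / exp (a * u)"

definition gamma_quot_min :: "nat \<Rightarrow> real \<Rightarrow> real" where
  "gamma_quot_min t a = (INF u\<in>{0<..<1}. gamma_quot t a u)"

definition q_ab :: "nat \<Rightarrow> real \<Rightarrow> real \<Rightarrow> real \<Rightarrow> real" where
  "q_ab t x a b =
     Max {gamma_quot_min t a, (1 + b) / exp b, exp (- (exp (- a) / (x ^ t * (1 + b) ^ t)))}"

definition ab_domain :: "nat \<Rightarrow> (real \<times> real) set" where
  "ab_domain t = {(a, b). a > euler_mascheroni * real t \<and> b > 0}"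

definition q_min :: "nat \<Rightarrow> real \<Rightarrow> real" where
  "q_min t x = (INF (a, b)\<in>ab_domain t. q_ab t x a b)"

definition x_bar :: "nat \<Rightarrow> real" where
  "x_bar t = Inf {x \<in> {exp (- euler_mascheroni)..exp 1}. (exp 1 / x) ^ t * q_min t x < 1}"

lemma euler_mascheroni_eq_neg_deriv_Gamma: "euler_mascheroni = - deriv Gamma (1 :: real)"
proof -
  have "(Gamma has_field_derivative (Gamma 1 * Digamma 1)) (at (1 :: real))"
    by (rule has_field_derivative_Gamma) simp
  then show ?thesis
    by (simp add: DERIV_imp_deriv)
qed

end

theory Submission
  imports Defs "HOL-Real_Asymp.Real_Asymp"
begin

text \<open>
  The first two terms of \<open>q(x; a, b)\<close> decrease strictly from \<open>1\<close> to \<open>0\<close> in \<open>a\<close> and in \<open>b\<close>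
  respectively, while the third increases strictly in both; hence all three agree at exactly one
  point, and any other point makes one of them larger.

  For the expectation, condition on the points of a chain. Its intervals are disjoint boxes, so the
  remaining points avoid them with probability at most \<open>exp (- (n - l) V)\<close>, where \<open>V\<close> is the sum of
  the volumes, i.e. of the products over the coordinates of the increments of the chain. Let
  \<open>c = exp (- a) / l\<^sup>t\<close>. If the product of all increments is at least \<open>c\<^sup>l\<close>, then \<open>V \<ge> l c\<close>;
  otherwise Markov's inequality with exponent \<open>u\<close> applies. Weighting each increment \<open>y\<close> by
  \<open>exp (- l y)\<close> decouples the increments and reduces everything to Gamma integrals, whence
  \<open>E[C\<^sub>l] \<le> (e\<^sup>t n / l\<^sup>t)\<^sup>l ((\<Gamma>(1 - u)\<^sup>t / exp (a u))\<^sup>l + exp (- (n - l) l c))\<close>.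
  This needs neither the second term of \<open>q\<close> nor \<open>b > 0\<close>; the slack \<open>b > 0\<close> absorbs the
  difference between \<open>n - l\<close> and \<open>n\<close>.

  A longest chain is maximal, and so are its initial segments, so a chain of length at least \<open>l\<close>
  forces \<open>C\<^sub>l \<ge> 1\<close>.
\<close>

section \<open>The function \<open>q\<close>\<close>

text \<open>Gamma has a simple pole at 0: \<open>Gamma (1 - u) = Gamma (2 - u) / (1 - u)\<close>
  with a numerator tending to 1. This keeps minimising sequences away from the right end of
  (0,1).\<close>

lemma tendsto_gamma_quot_at_left: "0 < t \<Longrightarrow> LIM u at_left 1. gamma_quot t a u :> at_top"
proof -
  assume t: "0 < t"
  have 1: "filterlim (\<lambda>u. Gamma (1 - u)) at_top (at_left (1::real))"
  proof -
    have *: "((\<lambda>u::real. Gamma (2 - u)) \<longlongrightarrow> Gamma (2 - 1)) (at_left 1)"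
      by (intro tendsto_intros) auto
    have **: "filterlim (\<lambda>u::real. inverse (1 - u)) at_top (at_left 1)"
      by real_asymp
    have "filterlim (\<lambda>u::real. Gamma (2 - u) * inverse (1 - u)) at_top (at_left 1)"
      by (rule filterlim_tendsto_pos_mult_at_top[OF * _ **]) auto
    moreover have "eventually (\<lambda>u::real. Gamma (2 - u) * inverse (1 - u) = Gamma (1 - u)) (at_left 1)"
      unfolding eventually_at_left_field
    proof (intro exI[of _ 0] conjI allI impI)
      fix u :: real assume "0 < u" "u < 1"
      then show "Gamma (2 - u) * inverse (1 - u) = Gamma (1 - u)"
        using Gamma_plus1[of "1 - u"] nonpos_Ints_nonpos[of "1 - u"]
        by (cases "1 - u \<in> \<int>\<^sub>\<le>\<^sub>0") (auto simp: field_simps)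
    qed simp
    ultimately show ?thesis
      by (simp add: filterlim_cong)
  qed
  have 2: "LIM u at_left (1::real). inverse (exp (a * u)) * Gamma (1 - u) ^ t :> at_top"
    by (rule filterlim_tendsto_pos_mult_at_top[where c = "inverse (exp a)"])
      (auto intro!: tendsto_eq_intros filterlim_pow_at_top 1 t)
  then show ?thesis
    by (simp add: gamma_quot_def[abs_def] field_simps)
qed

lemma gamma_quot_pos: "u < 1 \<Longrightarrow> 0 < gamma_quot t a u"
  by (simp add: gamma_quot_def Gamma_real_pos)

text \<open>Compares two values of \<open>a\<close> at the same \<open>u\<close>; monotonicity and
  continuity of the minimum in \<open>a\<close> both rest on this factor.\<close>

lemma gamma_quot_shift: "gamma_quot t a u = gamma_quot t a' u * exp ((a' - a) * u)"
  by (simp add: gamma_quot_def left_diff_distrib exp_diff)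

text \<open>Log-convexity of the Gamma function puts it above its tangent at \<open>1\<close>.\<close>

lemma gamma_quot_ge:
  assumes "u < 1"
  shows "exp (- (a - euler_mascheroni * real t) * u) \<le> gamma_quot t a u"
proof -
  have "(ln \<circ> Gamma) (1 - u) - (ln \<circ> Gamma) (1::real) \<ge> - euler_mascheroni * (1 - u - 1)"
    by (rule convex_on_imp_above_tangent[OF log_convex_Gamma_real])
      (use assms in \<open>auto intro!: derivative_eq_intros simp: o_def interior_open Digamma_1\<close>)
  then have "exp (euler_mascheroni * u) \<le> Gamma (1 - u)"
    using Gamma_real_pos[of "1 - u"] assms by (simp add: o_def ln_ge_iff)
  then have "exp (euler_mascheroni * u) ^ t \<le> Gamma (1 - u) ^ t"
    by (intro power_mono) auto
  then have "exp (euler_mascheroni * u) ^ t / exp (a * u) \<le> Gamma (1 - u) ^ t / exp (a * u)"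
    by (rule divide_right_mono) simp
  then show ?thesis
    by (simp add: gamma_quot_def exp_of_nat_mult[symmetric] exp_diff[symmetric] algebra_simps)
qed

text \<open>At \<open>u = 0\<close> the quotient is 1 and has derivative
  \<open>euler_mascheroni * t - a\<close>, since Digamma at 1 is minus the Euler-Mascheroni
  constant. The condition on \<open>a\<close> makes this slope negative.\<close>

lemma gamma_quot_less_1:
  assumes "a > euler_mascheroni * real t"
  obtains u where "u \<in> {0<..<1}" "gamma_quot t a u < 1"
proof -
  have "(gamma_quot t a has_real_derivative (euler_mascheroni * real t - a)) (at 0)"
    unfolding gamma_quot_def[abs_def]
    by (auto intro!: derivative_eq_intros simp: Digamma_1)
  from DERIV_neg_dec_right[OF this] assms obtain d where
    d: "d > 0" "\<And>h. 0 < h \<Longrightarrow> h < d \<Longrightarrow> gamma_quot t a (0 + h) < gamma_quot t a 0" by auto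
  define u where "u = min d 1 / 2"
  have "u \<in> {0<..<1}" "u < d" using d by (auto simp: u_def)
  with d(2)[of u] show ?thesis
    by (intro that[of u]) (auto simp: gamma_quot_def)
qed

text \<open>The interval is open, so compactness is applied to \<open>{0..c}\<close>. Neither the
  point 0 nor the points beyond \<open>c\<close> can compete, because the quotient is at least 1
  there and below 1 somewhere inside.\<close>

lemma gamma_quot_attains_min:
  assumes t: "0 < t" and a: "a > euler_mascheroni * real t"
  obtains u where "u \<in> {0<..<1}" "gamma_quot t a u < 1"
    "\<And>v. v \<in> {0<..<1} \<Longrightarrow> gamma_quot t a u \<le> gamma_quot t a v"
proof -
  obtain u0 where u0: "u0 \<in> {0<..<1}" "gamma_quot t a u0 < 1"
    using gamma_quot_less_1[OF a] .
  have "eventually (\<lambda>u. gamma_quot t a u \<ge> 1) (at_left 1)"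
    using tendsto_gamma_quot_at_left[OF t, of a] by (auto simp: filterlim_at_top)
  then obtain b where b: "b < 1" "\<And>u. b < u \<Longrightarrow> u < 1 \<Longrightarrow> gamma_quot t a u \<ge> 1"
    by (auto simp: eventually_at_left_field)
  \<comment> \<open>Beyond \<open>b\<close> the quotient is at least 1; the maximum with
    \<open>u0\<close> keeps a point with value below 1 inside \<open>{0..c}\<close>.\<close>
  define c where "c = max b u0"
  have c: "c < 1" "u0 \<in> {0..c}" using b u0 by (auto simp: c_def)
  have "continuous_on {0..c} (gamma_quot t a)"
    unfolding gamma_quot_def[abs_def] using c
    by (intro continuous_intros continuous_at_imp_continuous_on ballI isCont_Gamma)
      (auto dest: nonpos_Ints_nonpos)
  from continuous_attains_inf[OF _ _ this] c(2) obtain u where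
    u: "u \<in> {0..c}" "\<And>v. v \<in> {0..c} \<Longrightarrow> gamma_quot t a u \<le> gamma_quot t a v" by fastforce
  have less: "gamma_quot t a u < 1"
    using u(2)[OF c(2)] u0 by simp
  then have "u \<noteq> 0" by (auto simp: gamma_quot_def)
  with u c have "u \<in> {0<..<1}" by auto
  moreover have "gamma_quot t a u \<le> gamma_quot t a v" if "v \<in> {0<..<1}" for v
  proof (cases "v \<le> c")
    case False
    then have "gamma_quot t a v \<ge> 1" using that b by (auto simp: c_def)
    with less show ?thesis by simp
  qed (use u that in auto)
  ultimately show ?thesis using less that by blast
qed

lemma gamma_quot_min_attained:
  assumes "0 < t" "a > euler_mascheroni * real t"
  obtains u where "u \<in> {0<..<1}" "gamma_quot_min t a = gamma_quot t a u" "gamma_quot t a u < 1"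
proof -
  obtain u where u: "u \<in> {0<..<1}" "gamma_quot t a u < 1"
    "\<And>v. v \<in> {0<..<1} \<Longrightarrow> gamma_quot t a u \<le> gamma_quot t a v"
    using gamma_quot_attains_min[OF assms] by metis
  have "gamma_quot_min t a = gamma_quot t a u"
    unfolding gamma_quot_min_def using u by (intro cInf_eq_minimum) auto
  with u show ?thesis using that by blast
qed

lemma gamma_quot_min_le:
  assumes "u \<in> {0<..<1}"
  shows "gamma_quot_min t a \<le> gamma_quot t a u"
  unfolding gamma_quot_min_def
  by (rule cINF_lower) (use assms gamma_quot_pos in \<open>auto intro!: bdd_belowI2[of _ 0] less_imp_le\<close>)

context
  fixes t :: nat
  assumes t: "0 < t"
begin

lemma gamma_quot_min_bounds:
  assumes "a > euler_mascheroni * real t"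
  shows "0 < gamma_quot_min t a" "gamma_quot_min t a < 1"
  using gamma_quot_min_attained[OF t assms] gamma_quot_pos[of _ t a]
  by (metis greaterThanLessThan_iff)+

text \<open>The tangent bound \<open>gamma_quot_ge\<close> together with \<open>u < 1\<close>. The
  left side tends to 1 as \<open>a\<close> decreases to the boundary of the domain, which yields one
  of the two signs in \<open>balanced_point_exists\<close>.\<close>

lemma gamma_quot_min_ge:
  assumes "a > euler_mascheroni * real t"
  shows "exp (- (a - euler_mascheroni * real t)) \<le> gamma_quot_min t a"
proof -
  obtain u where u: "u \<in> {0<..<1}" "gamma_quot_min t a = gamma_quot t a u"
    using gamma_quot_min_attained[OF t assms] by metis
  have "- (a - euler_mascheroni * real t) \<le> - (a - euler_mascheroni * real t) * u"
    using u assms mult_left_le[of u "a - euler_mascheroni * real t"] by auto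
  then have "exp (- (a - euler_mascheroni * real t)) \<le> exp (- (a - euler_mascheroni * real t) * u)"
    by simp
  also have "\<dots> \<le> gamma_quot_min t a" using gamma_quot_ge[of u a t] u by simp
  finally show ?thesis .
qed

text \<open>The minimiser for \<open>a\<close>, used as a trial point for \<open>a'\<close>, already
  gains the factor \<open>exp ((a - a') * u) < 1\<close>.\<close>

lemma gamma_quot_min_strict_antimono:
  assumes "a > euler_mascheroni * real t" "a < a'"
  shows "gamma_quot_min t a' < gamma_quot_min t a"
proof -
  obtain u where u: "u \<in> {0<..<1}" "gamma_quot_min t a = gamma_quot t a u"
    using gamma_quot_min_attained[OF t assms(1)] by metis
  have "gamma_quot_min t a' \<le> gamma_quot t a' u" using u by (intro gamma_quot_min_le)
  also have "\<dots> = gamma_quot t a u * exp ((a - a') * u)" by (rule gamma_quot_shift)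
  also have "\<dots> < gamma_quot t a u * 1"
    using u assms gamma_quot_pos[of u t a] by (intro mult_strict_left_mono) (auto simp: mult_neg_pos)
  finally show ?thesis using u by simp
qed

text \<open>Conversely, the minimiser for \<open>a'\<close> as a trial point for \<open>a\<close>
  loses at most \<open>exp (a' - a)\<close>, because \<open>u < 1\<close>.\<close>

lemma gamma_quot_min_le_shift:
  assumes "a > euler_mascheroni * real t" "a \<le> a'"
  shows "gamma_quot_min t a \<le> gamma_quot_min t a' * exp (a' - a)"
proof -
  obtain u where u: "u \<in> {0<..<1}" "gamma_quot_min t a' = gamma_quot t a' u"
    using gamma_quot_min_attained[OF t, of a'] assms by (metis order_less_le_trans)
  have "gamma_quot_min t a \<le> gamma_quot t a u" using u by (intro gamma_quot_min_le)
  also have "\<dots> = gamma_quot t a' u * exp ((a' - a) * u)" by (rule gamma_quot_shift)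
  also have "\<dots> \<le> gamma_quot t a' u * exp (a' - a)"
    using u assms gamma_quot_pos[of u t a']
    by (intro mult_left_mono) (auto simp: mult_left_le)
  finally show ?thesis using u by simp
qed

text \<open>The logarithm of \<open>gamma_quot_min\<close> is \<open>1\<close>-Lipschitz, since the weight \<open>u\<close> lies in \<open>(0,1)\<close>.\<close>

lemma isCont_gamma_quot_min:
  assumes "a > euler_mascheroni * real t"
  shows "isCont (gamma_quot_min t) a"
proof -
  define c where "c = gamma_quot_min t a"
  have "(gamma_quot_min t \<longlongrightarrow> c) (at a)"
  proof (rule tendsto_sandwich)
    have ev: "eventually (\<lambda>y. y > euler_mascheroni * real t) (at a)"
      using assms by (intro order_tendstoD) auto
    show "eventually (\<lambda>y. c * exp (- \<bar>y - a\<bar>) \<le> gamma_quot_min t y) (at a)"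
      using ev
    proof eventually_elim
      case (elim y)
      show ?case
      proof (cases "y \<le> a")
        case True
        then have "c \<le> gamma_quot_min t y"
          using gamma_quot_min_strict_antimono[OF elim, of a] by (cases "y = a") (auto simp: c_def)
        moreover have "c * exp (- \<bar>y - a\<bar>) \<le> c * 1"
          using gamma_quot_min_bounds[OF assms] by (intro mult_left_mono) (auto simp: c_def)
        ultimately show ?thesis by simp
      next
        case False
        then show ?thesis using gamma_quot_min_le_shift[OF assms, of y]
          by (simp add: c_def exp_minus field_simps exp_diff)
      qed
    qed
    show "eventually (\<lambda>y. gamma_quot_min t y \<le> c * exp \<bar>y - a\<bar>) (at a)"
      using ev
    proof eventually_elim
      case (elim y)
      show ?case
      proof (cases "y \<le> a")
        case False
        then have "gamma_quot_min t y \<le> c"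
          using gamma_quot_min_strict_antimono[OF assms, of y] by (auto simp: c_def)
        also have "c * 1 \<le> c * exp \<bar>y - a\<bar>"
          using gamma_quot_min_bounds[OF assms] by (intro mult_left_mono) (auto simp: c_def)
        finally show ?thesis by simp
      next
        case True
        then show ?thesis using gamma_quot_min_le_shift[OF elim, of a]
          by (simp add: c_def exp_minus field_simps exp_diff)
      qed
    qed
    have "((\<lambda>y. c * exp (- \<bar>y - a\<bar>)) \<longlongrightarrow> c * exp (- \<bar>a - a\<bar>)) (at a)"
      by (intro tendsto_intros)
    then show "((\<lambda>y. c * exp (- \<bar>y - a\<bar>)) \<longlongrightarrow> c) (at a)" by simp
    have "((\<lambda>y. c * exp \<bar>y - a\<bar>) \<longlongrightarrow> c * exp \<bar>a - a\<bar>) (at a)"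
      by (intro tendsto_intros)
    then show "((\<lambda>y. c * exp \<bar>y - a\<bar>) \<longlongrightarrow> c) (at a)" by simp
  qed
  then show ?thesis by (simp add: isCont_def c_def)
qed

end

section \<open>The middle term of \<open>q\<close> and its inverse\<close>

text \<open>This is the Chernoff base for exponential variables: a sum of k independent standard
  exponentials exceeds (1 + b) k with probability at most \<open>chernoff b ^ k\<close>.\<close>

definition chernoff :: "real \<Rightarrow> real" where
  "chernoff b = (1 + b) / exp b"

text \<open>With h = b' - b, the numerator obeys 1 + b + h \<le> (1 + b)(1 + h) < (1 + b) exp h, so
  it grows more slowly than the denominator.\<close>

lemma chernoff_strict_antimono:
  assumes "0 \<le> b" "b < b'"
  shows "chernoff b' < chernoff b"
proof -
  have "1 + b' < (1 + b) * exp (b' - b)"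
  proof -
    have "1 + b' \<le> (1 + b) * (1 + (b' - b))"
      using assms by (simp add: algebra_simps mult_mono)
    also have "\<dots> < (1 + b) * exp (b' - b)"
      using assms exp_ge_add_one_self[of "b' - b"] exp_minus_greater[of "b - b'"]
      by (intro mult_strict_left_mono) auto
    finally show ?thesis .
  qed
  then show ?thesis by (simp add: chernoff_def exp_diff field_simps)
qed

lemma isCont_chernoff: "isCont chernoff b"
  unfolding chernoff_def[abs_def] by (intro continuous_intros) auto

lemma chernoff_surj:
  assumes "q \<in> {0<..<1}"
  obtains b where "b > 0" "chernoff b = q"
proof -
  have "(chernoff \<longlongrightarrow> 0) at_top" unfolding chernoff_def[abs_def] by real_asymp
  then have "eventually (\<lambda>b. chernoff b < q) at_top" using assms by (auto simp: order_tendsto_iff)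
  then obtain B where B: "\<And>b. b \<ge> B \<Longrightarrow> chernoff b < q" by (auto simp: eventually_at_top_linorder)
  have "chernoff (max 1 B) < q" using B by simp
  then have "\<exists>b. 0 \<le> b \<and> b \<le> max 1 B \<and> chernoff b = q"
    using assms isCont_chernoff by (intro IVT2) (auto simp: chernoff_def)
  then obtain b where b: "0 \<le> b" "chernoff b = q" by auto
  moreover have "b \<noteq> 0" using b assms by (auto simp: chernoff_def)
  ultimately show ?thesis using that[of b] by simp
qed

lemma chernoff_bounds: "0 < b \<Longrightarrow> 0 < chernoff b" "0 < b \<Longrightarrow> chernoff b < 1"
  using chernoff_strict_antimono[of 0 b] by (auto simp: chernoff_def)

text \<open>Meaningful for \<open>q\<close> in (0,1), where \<open>chernoff_surj\<close> and strict
  monotonicity single out one value.\<close>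

definition chernoff_inv :: "real \<Rightarrow> real" where
  "chernoff_inv q = (THE b. b > 0 \<and> chernoff b = q)"

lemma chernoff_inv_chernoff:
  assumes "b > 0"
  shows "chernoff_inv (chernoff b) = b"
  unfolding chernoff_inv_def
proof (rule the_equality)
  fix b' assume "0 < b' \<and> chernoff b' = chernoff b"
  then show "b' = b"
    using chernoff_strict_antimono[of b b'] chernoff_strict_antimono[of b' b] assms
    by (cases b b' rule: linorder_cases) auto
qed (use assms in auto)

lemma chernoff_inv:
  assumes "q \<in> {0<..<1}"
  shows "chernoff_inv q > 0" "chernoff (chernoff_inv q) = q"
  using chernoff_surj[OF assms] chernoff_inv_chernoff by metis+

lemma isCont_chernoff_inv:
  assumes "q \<in> {0<..<1}"
  shows "isCont chernoff_inv q"
proof -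
  define b where "b = chernoff_inv q"
  have b: "b > 0" "chernoff b = q" using chernoff_inv[OF assms] by (auto simp: b_def)
  \<comment> \<open>The interval from \<open>b / 2\<close> to \<open>b + 1\<close> surrounds
    \<open>b\<close> and stays among the positive reals, where \<open>chernoff_inv\<close> is a left
    inverse.\<close>
  have "isCont chernoff_inv (chernoff b)"
    by (rule isCont_inverse_function2[of "b / 2" b "b + 1"])
      (use b isCont_chernoff chernoff_inv_chernoff in auto)
  then show ?thesis by (simp add: b)
qed

lemma chernoff_inv_antimono:
  assumes "q \<in> {0<..<1}" "q' \<in> {0<..<1}" "q \<le> q'"
  shows "chernoff_inv q' \<le> chernoff_inv q"
  using chernoff_strict_antimono[of "chernoff_inv q" "chernoff_inv q'"]
    chernoff_inv[OF assms(1)] chernoff_inv[OF assms(2)] assms by (smt (verit))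

section \<open>The third term of \<open>q\<close> and the balanced point\<close>

text \<open>The third term of \<open>q\<close>; it stems from the probability that the intervals of
  a chain are void.\<close>

definition void_bound :: "nat \<Rightarrow> real \<Rightarrow> real \<Rightarrow> real \<Rightarrow> real" where
  "void_bound t x a b = exp (- (exp (- a) / (x ^ t * (1 + b) ^ t)))"

lemma q_ab_eq: "q_ab t x a b = max (gamma_quot_min t a) (max (chernoff b) (void_bound t x a b))"
  by (simp add: q_ab_def chernoff_def void_bound_def)

lemma void_bound_strict_mono:
  assumes "0 < t" "0 < x" "0 < b" "a \<le> a'" "b \<le> b'" "(a, b) \<noteq> (a', b')"
  shows "void_bound t x a b < void_bound t x a' b'"
proof -
  have pw: "(1 + b) ^ t \<le> (1 + b') ^ t" using assms by (intro power_mono) auto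
  have pos: "0 < x ^ t" "0 < (1 + b) ^ t" "0 < (1 + b') ^ t" using assms by auto
  have "exp (- a') / (x ^ t * (1 + b') ^ t) < exp (- a) / (x ^ t * (1 + b) ^ t)"
  proof (cases "a = a'")
    case True
    then have "(1 + b) ^ t < (1 + b') ^ t" using assms by (intro power_strict_mono) auto
    then show ?thesis
      unfolding \<open>a = a'\<close> using pos by (intro divide_strict_left_mono mult_strict_left_mono) auto
  next
    case False
    then have "exp (- a') < exp (- a)" using assms by simp
    then show ?thesis using pos pw by (intro frac_less) auto
  qed
  then show ?thesis by (simp add: void_bound_def)
qed

lemma void_bound_mono:
  assumes "0 < t" "0 < x" "0 < b" "a \<le> a'" "b \<le> b'"
  shows "void_bound t x a b \<le> void_bound t x a' b'"
  using void_bound_strict_mono[OF assms] by (cases "(a, b) = (a', b')") auto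

lemma void_bound_bounds:
  assumes "0 < x" "0 < b"
  shows "0 < void_bound t x a b" "void_bound t x a b < 1"
  using assms by (auto simp: void_bound_def)

text \<open>Equating the first two terms determines \<open>b = g a\<close>, an increasing function
  of \<open>a\<close>. Along this curve the third term increases while the first falls from near 1
  to 0, so the intermediate value theorem makes them meet.\<close>

lemma balanced_point_exists:
  assumes t: "0 < t" and x: "0 < x"
  obtains a b where "(a, b) \<in> ab_domain t" "gamma_quot_min t a = chernoff b"
    "chernoff b = void_bound t x a b"
proof -
  let ?A = "{euler_mascheroni * real t <..}"
  define g where "g a = chernoff_inv (gamma_quot_min t a)" for a
  have f1: "gamma_quot_min t a \<in> {0<..<1}" if "a \<in> ?A" for a
    using gamma_quot_min_bounds[OF t] that by auto
  have g: "g a > 0" "chernoff (g a) = gamma_quot_min t a" if "a \<in> ?A" for a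
    using chernoff_inv[OF f1[OF that]] by (auto simp: g_def)
  have f1_anti: "gamma_quot_min t a' \<le> gamma_quot_min t a" if "a \<in> ?A" "a \<le> a'" for a a'
    using gamma_quot_min_strict_antimono[OF t, of a a'] that by (cases "a = a'") auto
  have g_mono: "g a \<le> g a'" if "a \<in> ?A" "a \<le> a'" for a a'
    unfolding g_def using that f1 f1_anti by (intro chernoff_inv_antimono) auto
  define h where "h a = void_bound t x a (g a) - gamma_quot_min t a" for a
  have cont: "isCont h a" if "a \<in> ?A" for a
  proof -
    have "isCont (gamma_quot_min t) a" using isCont_gamma_quot_min[OF t] that by auto
    moreover have "isCont g a" unfolding g_def[abs_def]
      by (rule isCont_o2[where f = "gamma_quot_min t", OF _ isCont_chernoff_inv[OF f1[OF that]]])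
        (use isCont_gamma_quot_min[OF t] that in auto)
    ultimately show ?thesis
      unfolding h_def[abs_def] void_bound_def using g(1)[OF that] x
      by (intro continuous_intros) auto
  qed
  \<comment> \<open>An arbitrary reference point; the value \<open>k\<close> of the third term there
    separates the two terms on either side of \<open>a0\<close>.\<close>
  define a0 where "a0 = euler_mascheroni * real t + 1"
  define k where "k = void_bound t x a0 (g a0)"
  have a0: "a0 \<in> ?A" by (simp add: a0_def)
  have k: "0 < k" "k < 1" using void_bound_bounds[OF x g(1)[OF a0]] by (auto simp: k_def)
  \<comment> \<open>Being at most \<open>- ln k / 2\<close> above the boundary makes the first term
    exceed \<open>k\<close>; the cap 1 ensures \<open>a1 \<le> a0\<close>, so that the third term is
    at most \<open>k\<close>.\<close>
  define a1 where "a1 = euler_mascheroni * real t + min 1 (- ln k / 2)"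
  have a1: "a1 \<in> ?A" "a1 \<le> a0" using k by (auto simp: a1_def a0_def)
  have "k < exp (- (a1 - euler_mascheroni * real t))"
  proof -
    have "ln k < 0" using k by simp
    then have "exp (ln k) < exp (- min 1 (- ln k / 2))" unfolding exp_less_cancel_iff by linarith
    then show ?thesis using k by (simp add: a1_def)
  qed
  also have "\<dots> \<le> gamma_quot_min t a1" using a1 by (intro gamma_quot_min_ge t) auto
  finally have "k < gamma_quot_min t a1" .
  moreover have "void_bound t x a1 (g a1) \<le> k"
    unfolding k_def using a1 g g_mono x t by (intro void_bound_mono) auto
  ultimately have h1: "h a1 \<le> 0" by (simp add: h_def)
  \<comment> \<open>At the fixed trial point 1/2 the quotient decays exponentially in
    \<open>a\<close>, which bounds the minimum and gives the opposite sign.\<close>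
  have "((\<lambda>a. gamma_quot t a (1 / 2)) \<longlongrightarrow> 0) at_top"
    unfolding gamma_quot_def by real_asymp
  then have "eventually (\<lambda>a. gamma_quot t a (1 / 2) < k) at_top"
    using k by (auto simp: order_tendsto_iff)
  then have "eventually (\<lambda>a. gamma_quot t a (1 / 2) < k \<and> a \<ge> a0) at_top"
    by (intro eventually_conj eventually_ge_at_top)
  then obtain a2 where a2: "gamma_quot t a2 (1 / 2) < k" "a2 \<ge> a0"
    by (auto simp: eventually_at_top_linorder)
  have "k \<le> void_bound t x a2 (g a2)"
    unfolding k_def using a0 a2 g g_mono x t by (intro void_bound_mono) auto
  moreover have "gamma_quot_min t a2 < k"
    using gamma_quot_min_le[of "1/2" t a2] a2 by simp
  ultimately have h2: "h a2 \<ge> 0" by (simp add: h_def)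
  have "\<exists>a. a1 \<le> a \<and> a \<le> a2 \<and> h a = 0"
    using h1 h2 a1 a2 cont by (intro IVT) auto
  then obtain a where a: "a1 \<le> a" "h a = 0" by auto
  then have "a \<in> ?A" using a1 by auto
  with a g[of a] show ?thesis
    by (intro that[of a "g a"]) (auto simp: h_def ab_domain_def)
qed

text \<open>Where the three terms agree, a competitor of no larger value must lower or keep each of
  them. The first term then forces \<open>a \<le> a'\<close>, the second \<open>b \<le> b'\<close>,
  and the third excludes any strict increase.\<close>

lemma balanced_point_minimal:
  assumes t: "0 < t" and x: "0 < x"
    and ab: "(a, b) \<in> ab_domain t" "gamma_quot_min t a = chernoff b" "chernoff b = void_bound t x a b"
    and ab': "(a', b') \<in> ab_domain t" "q_ab t x a' b' \<le> q_ab t x a b"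
  shows "a' = a" "b' = b"
proof -
  have dom: "a > euler_mascheroni * real t" "b > 0" "a' > euler_mascheroni * real t" "b' > 0"
    using ab ab' by (auto simp: ab_domain_def)
  have *: "gamma_quot_min t a' \<le> gamma_quot_min t a" "chernoff b' \<le> chernoff b"
    "void_bound t x a' b' \<le> void_bound t x a b"
    using ab ab' by (auto simp: q_ab_eq)
  have "a \<le> a'"
    using *(1) gamma_quot_min_strict_antimono[OF t, of a' a] dom by (cases "a \<le> a'") auto
  moreover have "b \<le> b'"
    using *(2) chernoff_strict_antimono[of b' b] dom by (cases "b \<le> b'") auto
  ultimately have "(a, b) = (a', b')"
    using void_bound_strict_mono[OF t x dom(2), of a a' b'] *(3) by (meson linorder_not_less)
  then show "a' = a" "b' = b" by auto
qed

lemma q_ab_bounds: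
  assumes "0 < t" "0 < x" "(a, b) \<in> ab_domain t"
  shows "0 < q_ab t x a b" "q_ab t x a b < 1"
  using assms gamma_quot_min_bounds[OF assms(1), of a] chernoff_bounds[of b]
    void_bound_bounds[of x b t a]
  by (auto simp: q_ab_eq ab_domain_def)

lemma bdd_below_q_ab:
  assumes "0 < t" "0 < x"
  shows "bdd_below ((\<lambda>(a, b). q_ab t x a b) ` ab_domain t)"
  using q_ab_bounds[OF assms] by (intro bdd_belowI2[of _ 0]) (auto intro: less_imp_le)

lemma ab_domain_nonempty: "ab_domain t \<noteq> {}"
proof -
  have "(euler_mascheroni * real t + 1, 1) \<in> ab_domain t"
    by (simp add: ab_domain_def)
  then show ?thesis by blast
qed

text \<open>By \<open>balanced_point_minimal\<close> every competitor as good as the balanced point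
  coincides with it; hence the only minimiser satisfies the balance equations.\<close>

lemma minimal_q_ab:
  assumes t: "0 < t" and x: "0 < x"
  defines "m \<equiv> is_arg_min (\<lambda>(a, b). q_ab t x a b) (\<lambda>p. p \<in> ab_domain t)"
  shows "\<exists>!p. m p"
    and "m (a, b) \<Longrightarrow> q_min t x = q_ab t x a b \<and> gamma_quot_min t a = chernoff b \<and>
           chernoff b = void_bound t x a b"
proof -
  obtain a0 b0 where ab0: "(a0, b0) \<in> ab_domain t" "gamma_quot_min t a0 = chernoff b0"
    "chernoff b0 = void_bound t x a0 b0"
    using balanced_point_exists[OF t x] .
  note min = balanced_point_minimal[OF t x ab0]
  have m0: "m (a0, b0)"
    unfolding m_def is_arg_min_def using ab0 min by (force simp: not_less)
  have uniq: "a = a0 \<and> b = b0" if "m (a, b)" for a b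
    using that ab0(1) min[of a b] unfolding m_def is_arg_min_def by (force simp: not_less)
  show "\<exists>!p. m p"
  proof (rule ex1I[of _ "(a0, b0)"])
    show "p = (a0, b0)" if "m p" for p using uniq that by (cases p) simp
  qed (rule m0)
  assume "m (a, b)"
  then have [simp]: "a = a0" "b = b0" using uniq by auto
  have "q_min t x = q_ab t x a0 b0"
    unfolding q_min_def
  proof (rule cInf_eq_minimum)
    show "q_ab t x a0 b0 \<in> (\<lambda>(a, b). q_ab t x a b) ` ab_domain t"
      using ab0(1) by force
    show "q_ab t x a0 b0 \<le> y" if "y \<in> (\<lambda>(a, b). q_ab t x a b) ` ab_domain t" for y
      using that m0 unfolding m_def is_arg_min_def by (force simp: not_less)
  qed
  with ab0 show "q_min t x = q_ab t x a b \<and> gamma_quot_min t a = chernoff b \<and>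
           chernoff b = void_bound t x a b" by simp
qed

lemma q_min_le:
  assumes "0 < t" "0 < x" "(a, b) \<in> ab_domain t"
  shows "q_min t x \<le> q_ab t x a b"
  unfolding q_min_def using cINF_lower[OF bdd_below_q_ab[OF assms(1,2)] assms(3)] by simp

lemma q_min_less:
  assumes "0 < t" "0 < x" "q_min t x < c"
  obtains a b where "(a, b) \<in> ab_domain t" "q_ab t x a b < c"
  using assms cINF_less_iff[OF ab_domain_nonempty bdd_below_q_ab[OF assms(1,2)]]
  unfolding q_min_def by fastforce

section \<open>The threshold \<open>x_bar\<close>\<close>

lemma exp_minus_euler_mascheroni_less: "exp (- euler_mascheroni) < exp (1::real)"
  using euler_mascheroni_pos by simp

text \<open>At \<open>x = exp 1\<close> the prefactor is 1 and \<open>q\<close> is below 1, so there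
  is room to move slightly to the left.\<close>

lemma x_bar_less:
  assumes t: "0 < t"
  shows "x_bar t < exp 1"
proof -
  \<comment> \<open>With \<open>(a, b)\<close> fixed, continuity of an explicit function of
    \<open>x\<close> suffices, and \<open>q_min\<close> lies below \<open>q_ab\<close> at that
    point.\<close>
  define a b :: real where "a = euler_mascheroni * real t + 1" and "b = 1"
  have ab: "(a, b) \<in> ab_domain t" by (simp add: a_def b_def ab_domain_def)
  define f where "f x = (exp 1 / x) ^ t * q_ab t x a b" for x
  have "isCont f (exp 1)"
    unfolding f_def[abs_def] q_ab_eq void_bound_def using ab
    by (intro continuous_intros) (auto simp: b_def)
  then have "(f \<longlongrightarrow> f (exp 1)) (at_left (exp 1))"
    by (simp add: isCont_def filterlim_at_split)
  moreover have "f (exp 1) < 1"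
    using q_ab_bounds[OF t _ ab, of "exp 1"] by (simp add: f_def)
  ultimately have "eventually (\<lambda>x. f x < 1) (at_left (exp 1))"
    by (auto simp: order_tendsto_iff)
  moreover have "eventually (\<lambda>x. x > exp (- euler_mascheroni) \<and> x < exp (1::real)) (at_left (exp 1))"
    using exp_minus_euler_mascheroni_less unfolding eventually_at_left_field by blast
  ultimately have "eventually (\<lambda>x. f x < 1 \<and> x > exp (- euler_mascheroni) \<and> x < exp (1::real)) (at_left (exp 1))"
    by eventually_elim auto
  from eventually_happens'[OF _ this] obtain x where
    x: "f x < 1" "x > exp (- euler_mascheroni)" "x < exp (1::real)" by auto
  have x0: "x > 0" using x(2) by (meson exp_gt_zero order_less_trans)
  have "(exp 1 / x) ^ t * q_min t x \<le> f x"
    unfolding f_def using x0 q_min_le[OF t x0 ab] by (intro mult_left_mono) auto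
  then have "x_bar t \<le> x"
    unfolding x_bar_def using x
    by (intro cInf_lower bdd_belowI[of _ "exp (- euler_mascheroni)"]) auto
  with x show ?thesis by simp
qed

text \<open>
  The constraint \<open>x \<ge> exp (- \<gamma>)\<close> enters through the map \<open>s \<mapsto> s exp (- k s)\<close>, \<open>s = x\<^sup>-\<^sup>t\<close>, which
  increases only for \<open>k s \<le> 1\<close>.
\<close>

lemma x_bar_witness:
  assumes t: "0 < t" and e: "0 < e"
  obtains x a b u where "0 < x" "x < x_bar t + e" "0 < b" "u \<in> {0<..<1}"
    "exp (- a) \<le> x ^ t"
    "(exp 1 / x) ^ t * gamma_quot t a u < 1"
    "(exp 1 / x) ^ t * void_bound t x a b < 1"
proof -
  let ?S = "{x \<in> {exp (- euler_mascheroni)..exp 1}. (exp 1 / x) ^ t * q_min t x < 1}"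
  have bdd: "bdd_below ?S" by (intro bdd_belowI[of _ "exp (- euler_mascheroni)"]) auto
  have "?S \<noteq> {}"
  proof -
    have "(euler_mascheroni * real t + 1, 1::real) \<in> ab_domain t" by (auto simp: ab_domain_def)
    from q_min_le[OF t _ this, of "exp 1"] q_ab_bounds[OF t _ this, of "exp 1"]
    have "exp 1 \<in> ?S" using exp_minus_euler_mascheroni_less by auto
    then show ?thesis by blast
  qed
  \<comment> \<open>The infimum itself may fail to belong to \<open>?S\<close>, so a member of
    \<open>?S\<close> below \<open>x_bar t + e\<close> takes its place.\<close>
  from cInf_lessD[OF this, of "x_bar t + e"] e obtain x where x: "x \<in> ?S" "x < x_bar t + e"
    by (auto simp: x_bar_def)
  then have "exp (- euler_mascheroni) \<le> x" by auto
  then have x0: "0 < x" by (meson exp_gt_zero order_less_le_trans)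
  have pos: "(exp 1 / x) ^ t > 0" using x0 by simp
  have "q_min t x < 1 / (exp 1 / x) ^ t" 
    using x pos by (simp add: less_divide_eq mult.commute)
  from q_min_less[OF t x0 this] obtain a b where ab: "(a, b) \<in> ab_domain t"
    "q_ab t x a b < 1 / (exp 1 / x) ^ t" .
  then have "gamma_quot_min t a < 1 / (exp 1 / x) ^ t" "void_bound t x a b < 1 / (exp 1 / x) ^ t"
    by (auto simp: q_ab_eq)
  then have *: "(exp 1 / x) ^ t * gamma_quot_min t a < 1" "(exp 1 / x) ^ t * void_bound t x a b < 1"
    using pos by (simp_all add: less_divide_eq mult.commute)
  obtain u where u: "u \<in> {0<..<1}" "gamma_quot_min t a = gamma_quot t a u"
    using gamma_quot_min_attained[OF t, of a] ab by (auto simp: ab_domain_def)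
  have "exp (- a) \<le> exp (- euler_mascheroni) ^ t"
    using ab by (simp add: ab_domain_def exp_of_nat_mult[symmetric] mult.commute)
  also have "\<dots> \<le> x ^ t" using \<open>exp (- euler_mascheroni) \<le> x\<close> by (intro power_mono) auto
  finally show ?thesis using that[OF x0 x(2) _ u(1), of b a] * ab u by (auto simp: ab_domain_def)
qed

section \<open>Maximal chains\<close>

lemma chain_point_Suc: "k < length is \<Longrightarrow> chain_point x is (Suc k) = x (is ! k)"
  by (simp add: chain_point_def)

lemma is_chain_nth:
  assumes "is_chain x n is" "i < length is" "j < length is"
  shows "i \<le> j \<Longrightarrow> x (is ! i) \<le> x (is ! j)" "i \<noteq> j \<Longrightarrow> x (is ! i) \<noteq> x (is ! j)"
proof -
  show "x (is ! i) \<le> x (is ! j)" if "i \<le> j"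
    using assms that unfolding is_chain_def sorted_wrt_iff_nth_less
    by (cases "i = j") (auto simp: order_less_le)
  show "x (is ! i) \<noteq> x (is ! j)" if "i \<noteq> j"
    using assms that unfolding is_chain_def distinct_conv_nth by auto
qed

text \<open>Quantifiers over positions reduce measurability of the event to atoms comparing two
  sample points.\<close>

lemma is_chain_iff:
  "is_chain x n is \<longleftrightarrow> set is \<subseteq> {1..n} \<and>
     (\<forall>i<length is. \<forall>j<length is. i \<noteq> j \<longrightarrow> x (is ! i) \<noteq> x (is ! j)) \<and>
     (\<forall>i<length is. \<forall>j<length is. i < j \<longrightarrow> x (is ! i) \<le> x (is ! j))"
  by (auto simp: is_chain_def sorted_wrt_iff_nth_less distinct_conv_nth)

lemma is_chain_distinct: "is_chain x n is \<Longrightarrow> distinct is"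
  by (auto simp: is_chain_def distinct_map)

lemma is_chain_cong:
  assumes "\<And>i. i \<in> {1..n} \<Longrightarrow> x i = y i"
  shows "is_chain x n is = is_chain y n is"
proof (cases "set is \<subseteq> {1..n}")
  case True
  then have "map x is = map y is" using assms by auto
  show ?thesis unfolding is_chain_def \<open>map x is = map y is\<close> ..
qed (simp add: is_chain_def)

lemma finite_chains: "finite {is. is_chain x n is}"
proof (rule finite_subset)
  show "{is. is_chain x n is} \<subseteq> {is. set is \<subseteq> {1..n} \<and> length is \<le> n}"
  proof safe
    fix "is" assume *: "is_chain x n is"
    then have "set is \<subseteq> {1..n}" by (simp add: is_chain_def)
    then have "card (set is) \<le> n" using card_mono[of "{1..n}" "set is"] by simp
    then show "length is \<le> n" using is_chain_distinct[OF *] by (simp add: distinct_card)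
  qed (auto simp: is_chain_def)
  show "finite {is. set is \<subseteq> {1..n} \<and> length is \<le> n}"
    by (rule finite_lists_length_le) simp
qed

text \<open>Intervals are renumbered from 0 instead of 1, so that the upper end of the k-th one is
  \<open>is ! k\<close>.\<close>

lemma is_maximal_chain_iff:
  "is_maximal_chain x n is \<longleftrightarrow> is_chain x n is \<and>
     (\<forall>k<length is. \<forall>j\<in>{1..n} - set is.
        \<not> (chain_point x is k \<le> x j \<and> x j \<le> x (is ! k) \<and>
            x j \<noteq> chain_point x is k \<and> x j \<noteq> x (is ! k)))"
proof -
  have *: "(chain_interval x n is (Suc k) = {}) =
      (\<forall>j\<in>{1..n} - set is. \<not> (chain_point x is k \<le> x j \<and> x j \<le> x (is ! k) \<and>
        x j \<noteq> chain_point x is k \<and> x j \<noteq> x (is ! k)))" if "k < length is" for k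
    using that by (auto simp: chain_interval_def chain_point_Suc)
  have all_Suc: "(\<forall>k\<in>{1..length is}. P k) \<longleftrightarrow> (\<forall>k<length is. P (Suc k))" for P
    unfolding image_Suc_lessThan[symmetric] by blast
  show ?thesis
    unfolding is_maximal_chain_def all_Suc by (intro conj_cong refl all_cong *)
qed

text \<open>Allows the sample to be replaced by its restriction to \<open>{1..n}\<close>, which is a
  point of the product space.\<close>

lemma is_maximal_chain_cong:
  assumes "\<And>i. i \<in> {1..n} \<Longrightarrow> x i = y i"
  shows "is_maximal_chain x n is = is_maximal_chain y n is"
proof (cases "set is \<subseteq> {1..n}")
  case True
  then have nth: "x (is ! k) = y (is ! k)" if "k < length is" for k
    using assms that nth_mem by blast
  then have "chain_point x is k = chain_point y is k" if "k < length is" for k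
    using that by (simp add: chain_point_def)
  with nth show ?thesis
    unfolding is_maximal_chain_iff using assms is_chain_cong[of n x y] by auto
qed (simp add: is_maximal_chain_def is_chain_def)

text \<open>Truncation turns the dropped chain points into ordinary sample points. They lie above
  all retained points, hence strictly inside no remaining interval.\<close>

lemma is_maximal_chain_take:
  assumes "is_maximal_chain x n is"
  shows "is_maximal_chain x n (take l is)"
  unfolding is_maximal_chain_iff
proof (intro conjI allI impI ballI notI)
  have chain: "is_chain x n is" using assms by (simp add: is_maximal_chain_def)
  then show "is_chain x n (take l is)"
    unfolding is_chain_def
    by (auto simp: take_map[symmetric] intro: sorted_wrt_take dest: in_set_takeD)
  fix k j
  assume k: "k < length (take l is)" and j: "j \<in> {1..n} - set (take l is)"
    and between: "chain_point x (take l is) k \<le> x j \<and> x j \<le> x (take l is ! k) \<and>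
      x j \<noteq> chain_point x (take l is) k \<and> x j \<noteq> x (take l is ! k)"
  have eq: "chain_point x (take l is) k = chain_point x is k" "take l is ! k = is ! k"
    using k by (auto simp: chain_point_def)
  have "j \<notin> set is"
  proof
    assume "j \<in> set is"
    then obtain i where i: "i < length is" "j = is ! i" by (auto simp: in_set_conv_nth)
    have "\<not> i < l"
      using i j by (auto simp: in_set_conv_nth)
    then have "x (is ! k) \<le> x j"
      using is_chain_nth(1)[OF chain, of k i] i k by auto
    with between eq show False by auto
  qed
  with j have "j \<in> {1..n} - set is" by blast
  moreover have "k < length is" using k by simp
  ultimately show False
    using assms between unfolding eq is_maximal_chain_iff by blast
qed

text \<open>A point inside an interval could be inserted there, giving a longer chain.\<close>

lemma longest_chain_is_maximal:
  assumes chain: "is_chain x n is" and longest: "\<And>js. is_chain x n js \<Longrightarrow> length js \<le> length is"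
  shows "is_maximal_chain x n is"
  unfolding is_maximal_chain_iff
proof (intro conjI allI impI ballI notI chain)
  fix k j
  assume k: "k < length is" and j: "j \<in> {1..n} - set is"
    and between: "chain_point x is k \<le> x j \<and> x j \<le> x (is ! k) \<and>
      x j \<noteq> chain_point x is k \<and> x j \<noteq> x (is ! k)"
  then have b: "chain_point x is k \<le> x j" "x j \<le> x (is ! k)"
    "x j \<noteq> chain_point x is k" "x j \<noteq> x (is ! k)" by auto
  \<comment> \<open>For \<open>k = 0\<close> the lower end is the origin and not a chain member; the
    new point then goes in front and \<open>before\<close> is vacuous.\<close>
  define js where "js = take k is @ j # drop k is"
  have before: "x i \<le> x j \<and> x i \<noteq> x j" if "i \<in> set (take k is)" for i
  proof -
    obtain m where "m < length (take k is)" "take k is ! m = i"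
      using \<open>i \<in> set (take k is)\<close> unfolding in_set_conv_nth by blast
    then have m: "m < k" "i = is ! m" by auto
    have "x i \<le> x (is ! (k - 1))" using is_chain_nth(1)[OF chain, of m "k - 1"] m k by auto
    moreover have "chain_point x is k = x (is ! (k - 1))" using m by (simp add: chain_point_def)
    ultimately have "x i \<le> chain_point x is k" by simp
    with b have "x i \<le> x j" "x i \<noteq> x j" by order+
    then show ?thesis ..
  qed
  have after: "x j \<le> x i \<and> x j \<noteq> x i" if "i \<in> set (drop k is)" for i
  proof -
    obtain m where "m < length (drop k is)" "drop k is ! m = i"
      using \<open>i \<in> set (drop k is)\<close> unfolding in_set_conv_nth by blast
    then have m: "k + m < length is" "i = is ! (k + m)" by auto
    then have "x (is ! k) \<le> x i" using is_chain_nth(1)[OF chain, of k "k + m"] k by auto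
    with b have "x j \<le> x i" "x j \<noteq> x i" by order+
    then show ?thesis ..
  qed
  have split: "map x is = map x (take k is) @ map x (drop k is)"
    by (metis append_take_drop_id map_append)
  have "is_chain x n js"
    using chain before after j unfolding is_chain_def js_def split sorted_wrt_append distinct_append
    by (auto dest: in_set_takeD in_set_dropD simp: sorted_wrt_append) force+
  then have "length js \<le> length is" by (rule longest)
  then show False using k by (simp add: js_def)
qed

text \<open>A longest chain is maximal and can be cut to length \<open>l\<close>. This is what
  transfers a first moment bound to the longest chain.\<close>

lemma num_maximal_chains_pos_iff:
  "0 < num_maximal_chains x n l \<longleftrightarrow> l \<le> longest_chain_length x n"
proof
  let ?S = "{is. is_chain x n is}"
  have le: "length js \<le> longest_chain_length x n" if "is_chain x n js" for js
    unfolding longest_chain_length_def using that finite_chains by (intro Max_ge) auto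
  have fin: "finite {is. is_maximal_chain x n is \<and> length is = l}"
    by (rule finite_subset[OF _ finite_chains]) (auto simp: is_maximal_chain_def)
  show "l \<le> longest_chain_length x n" if "0 < num_maximal_chains x n l"
    using that le unfolding num_maximal_chains_def card_gt_0_iff is_maximal_chain_def by auto
  assume l: "l \<le> longest_chain_length x n"
  have "[] \<in> ?S" by (simp add: is_chain_def)
  then have "longest_chain_length x n \<in> length ` ?S"
    unfolding longest_chain_length_def using finite_chains by (intro Max_in) auto
  then obtain "is" where "is": "is_chain x n is" "length is = longest_chain_length x n" by auto
  then have "is_maximal_chain x n is" using le longest_chain_is_maximal by metis
  then have "take l is \<in> {is. is_maximal_chain x n is \<and> length is = l}"
    using is_maximal_chain_take "is" l by auto
  then show "0 < num_maximal_chains x n l"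
    unfolding num_maximal_chains_def using fin card_gt_0_iff by blast
qed

section \<open>Measurability of the event that a list is a maximal chain\<close>

lemma pred_vec_le [measurable (raw)]:
  fixes f g :: "'a \<Rightarrow> real ^ 't::finite"
  assumes [measurable]: "f \<in> borel_measurable M" "g \<in> borel_measurable M"
  shows "Measurable.pred M (\<lambda>x. f x \<le> g x)"
proof -
  have [measurable]: "(\<lambda>x. f x $ s) \<in> borel_measurable M" "(\<lambda>x. g x $ s) \<in> borel_measurable M" for s
    by (auto intro: measurable_compose[OF _ borel_measurable_nth] assms)
  show ?thesis unfolding less_eq_vec_def by measurable
qed

lemma pred_vec_eq [measurable (raw)]:
  fixes f g :: "'a \<Rightarrow> real ^ 't::finite"
  assumes [measurable]: "f \<in> borel_measurable M" "g \<in> borel_measurable M"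
  shows "Measurable.pred M (\<lambda>x. f x = g x)"
  unfolding order.eq_iff by measurable

lemma measurable_is_maximal_chain:
  fixes X :: "nat \<Rightarrow> 'a \<Rightarrow> real ^ 't::finite"
  assumes X: "\<And>i. i \<in> {1..n} \<Longrightarrow> X i \<in> borel_measurable M"
  shows "Measurable.pred M (\<lambda>\<omega>. is_maximal_chain (\<lambda>i. X i \<omega>) n is)"
proof (cases "set is \<subseteq> {1..n}")
  case True
  have Xj: "X j \<in> borel_measurable M" if "j \<in> {1..n} - set is" for j
    using X that by auto
  have nth: "X (is ! k) \<in> borel_measurable M" if "k \<in> {..<length is}" for k
    using X True that nth_mem by blast
  have cp: "(\<lambda>\<omega>. chain_point (\<lambda>i. X i \<omega>) is k) \<in> borel_measurable M"
    if "k \<in> {..<length is}" for k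
    unfolding chain_point_def using nth[of "k - 1"] that by (cases "k = 0") auto
  \<comment> \<open>\<open>pred_intros_finite\<close> handles quantifiers ranging over finite sets,
    so bounds on positions are rewritten as membership.\<close>
  have all_less: "(\<forall>i<m. P i) \<longleftrightarrow> (\<forall>i\<in>{..<m}. P i)" for m :: nat and P by auto
  show ?thesis
    unfolding is_maximal_chain_iff is_chain_iff all_less
    by (intro pred_intros_logic pred_intros_finite finite_lessThan finite_Diff finite_atLeastAtMost
        pred_vec_le pred_vec_eq nth cp Xj) auto
qed (simp add: is_maximal_chain_def is_chain_def)

section \<open>Integrals over chains\<close>

lemma prod_Basis_vec:
  "(\<Prod>b\<in>(Basis :: (real ^ 't::finite) set). f b) = (\<Prod>s\<in>UNIV. f (axis s 1))"
proof -
  have Basis: "Basis = range (\<lambda>s. axis s (1::real) :: real ^ 't)"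
    by (auto simp: Basis_vec_def)
  have "inj (\<lambda>s. axis s (1::real) :: real ^ 't)"
    by (auto intro!: injI simp: axis_eq_axis)
  then show ?thesis unfolding Basis by (subst prod.reindex) (simp_all add: o_def)
qed

lemma emeasure_lborel_box_vec:
  fixes a b :: "real ^ 't::finite"
  assumes "a \<le> b"
  shows "emeasure lborel (box a b) = ennreal (\<Prod>s\<in>UNIV. b $ s - a $ s)"
proof (subst emeasure_lborel_box)
  show "a \<bullet> e \<le> b \<bullet> e" if "e \<in> Basis" for e
    using assms that by (auto simp: less_eq_vec_def Basis_vec_def inner_axis)
qed (simp add: prod_Basis_vec inner_axis)

lemma emeasure_lborel_unit_cube: "emeasure lborel (cbox 0 (1 :: real ^ 't::finite)) = 1"
proof (subst emeasure_lborel_cbox)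
  show "(0 :: real ^ 't) \<bullet> e \<le> 1 \<bullet> e" if "e \<in> Basis" for e
    using that by (auto simp: Basis_vec_def inner_axis)
qed (simp add: prod_Basis_vec inner_axis)

lemma nn_integral_lborel_prod_vec:
  fixes f :: "real \<Rightarrow> ennreal"
  assumes [measurable]: "f \<in> borel_measurable borel"
  shows "(\<integral>\<^sup>+y. (\<Prod>s\<in>UNIV. f (y $ s)) \<partial>(lborel :: (real ^ 't::finite) measure)) =
    (\<integral>\<^sup>+y. f y \<partial>lborel) ^ CARD('t)"
  using nn_integral_lborel_prod[of "\<lambda>_ :: real ^ 't. f"]
  by (simp add: prod_Basis_vec inner_axis)

lemma nn_integral_lborel_shift:
  fixes z :: "'a::euclidean_space"
  assumes [measurable]: "f \<in> borel_measurable borel"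
  shows "(\<integral>\<^sup>+y. f (y - z) \<partial>lborel) = (\<integral>\<^sup>+y. f y \<partial>lborel)"
proof -
  have "(\<integral>\<^sup>+y. f y \<partial>lborel) = (\<integral>\<^sup>+y. f y \<partial>distr lborel borel ((+) (- z)))"
    by (simp add: lborel_distr_plus)
  also have "\<dots> = (\<integral>\<^sup>+y. f (y - z) \<partial>lborel)"
    by (subst nn_integral_distr) simp_all
  finally show ?thesis by simp
qed

text \<open>
  Tilting by \<open>exp (- l y)\<close> removes the constraint that the increments of a chain sum to at most \<open>1\<close>.
  The value \<open>\<top>\<close> at \<open>0\<close> makes the pointwise estimates valid also for chains
  with coinciding coordinates, where \<open>powr\<close> would give the junk value \<open>0\<close>.
\<close>

definition kernel :: "real \<Rightarrow> real \<Rightarrow> real \<Rightarrow> ennreal" where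
  "kernel l v y = (if y < 0 then 0 else if y = 0 then \<top> else ennreal (exp (- l * y) * y powr - v))"

lemma measurable_kernel [measurable]: "kernel l v \<in> borel_measurable borel"
  unfolding kernel_def by measurable

text \<open>Since 0 times \<top> is 0 in \<open>ennreal\<close>, an infinite factor makes a product
  infinite only if no factor vanishes.\<close>

lemma kernel_neq_0: "0 \<le> y \<Longrightarrow> kernel l v y \<noteq> 0"
  by (auto simp: kernel_def)

text \<open>The substitution of \<open>y / l\<close> for \<open>y\<close> leads to Euler's integral,
  convergent for \<open>v < 1\<close>; the infinite value at 0 sits on a null set.\<close>

lemma nn_integral_kernel:
  assumes l: "0 < l" and v: "v < 1"
  shows "(\<integral>\<^sup>+y. kernel l v y \<partial>lborel) = ennreal (Gamma (1 - v) * l powr (v - 1))"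
proof -
  let ?f = "\<lambda>y. ennreal (indicator {0..} y * y powr (1 - v - 1) * exp (- l * y))"
  have "(\<integral>\<^sup>+y. kernel l v y \<partial>lborel) = (\<integral>\<^sup>+y. ?f y \<partial>lborel)"
    by (rule nn_integral_cong_AE, use AE_lborel_singleton[of "0::real"] in eventually_elim)
      (auto simp: kernel_def indicator_def mult.commute)
  also have "\<dots> = ennreal \<bar>1 / l\<bar> * (\<integral>\<^sup>+y. ?f (0 + 1 / l * y) \<partial>lborel)"
    by (rule nn_integral_real_affine) (use l in auto)
  also have "(\<integral>\<^sup>+y. ?f (0 + 1 / l * y) \<partial>lborel) =
      (\<integral>\<^sup>+y. ennreal (l powr v) * ennreal (indicator {0..} y * y powr (1 - v - 1) / exp y) \<partial>lborel)"
    by (rule nn_integral_cong)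
      (use l in \<open>auto simp: indicator_def ennreal_mult'[symmetric] powr_divide powr_minus
        exp_minus field_simps zero_le_divide_iff\<close>)
  also have "\<dots> = ennreal (l powr v) * ennreal (Gamma (1 - v))"
    using v by (subst nn_integral_cmult) (auto simp: Gamma_conv_nn_integral_real)
  also have "ennreal \<bar>1 / l\<bar> * \<dots> = ennreal (Gamma (1 - v) * l powr (v - 1))"
    using l v by (simp add: ennreal_mult'[symmetric] powr_diff)
  finally show ?thesis .
qed

lemma nn_integral_kernel_vec:
  assumes "0 < l" "v < 1"
  shows "(\<integral>\<^sup>+y. (\<Prod>s\<in>UNIV. kernel l v (y $ s)) \<partial>(lborel :: (real ^ 't::finite) measure)) =
    ennreal ((Gamma (1 - v) * l powr (v - 1)) ^ CARD('t))"
  using assms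
  by (subst nn_integral_lborel_prod_vec) (simp_all add: nn_integral_kernel ennreal_power)

lemma prod_kernel_eq:
  assumes "finite P" "\<And>p. p \<in> P \<Longrightarrow> 0 < d p"
  shows "(\<Prod>p\<in>P. kernel l v (d p)) = ennreal (exp (- l * (\<Sum>p\<in>P. d p)) * (\<Prod>p\<in>P. d p) powr - v)"
proof -
  have "(\<Prod>p\<in>P. kernel l v (d p)) = (\<Prod>p\<in>P. ennreal (exp (- l * d p) * d p powr - v))"
  proof (intro prod.cong refl)
    show "kernel l v (d p) = ennreal (exp (- l * d p) * d p powr - v)" if "p \<in> P" for p
      using assms(2)[OF that] by (simp add: kernel_def)
  qed
  also have "\<dots> = ennreal (\<Prod>p\<in>P. exp (- l * d p) * d p powr - v)"
    by (rule prod_ennreal) simp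
  also have "(\<Prod>p\<in>P. exp (- l * d p) * d p powr - v) =
      exp (- l * (\<Sum>p\<in>P. d p)) * (\<Prod>p\<in>P. d p) powr - v"
    by (simp add: prod.distrib exp_sum[OF assms(1), symmetric] prod_powr_distrib sum_distrib_left
        sum_negf)
  finally show ?thesis .
qed

text \<open>
  With \<open>D\<close> the product of all increments: if \<open>D < c\<^sup>l\<close>, then \<open>(c\<^sup>l / D)\<^sup>u \<ge> 1\<close>;
  otherwise the volumes sum to at least \<open>l c\<close> by the inequality of arithmetic and geometric means.
\<close>

lemma void_probability_le_kernels:
  fixes d :: "nat \<Rightarrow> real ^ 't::finite" and l :: nat
  assumes l: "0 < l" and c: "0 < c" and u: "0 \<le> u" and m: "0 \<le> m"
    and d: "\<And>k s. k < l \<Longrightarrow> 0 \<le> d k $ s"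
    and sum_le: "\<And>s. (\<Sum>k<l. d k $ s) \<le> 1"
  shows "ennreal (exp (- m * (\<Sum>k<l. \<Prod>s\<in>UNIV. d k $ s))) \<le>
    ennreal (exp (real l * real CARD('t))) *
      (ennreal (c powr (u * real l)) * (\<Prod>k<l. \<Prod>s\<in>UNIV. kernel (real l) u (d k $ s)) +
       ennreal (exp (- m * real l * c)) * (\<Prod>k<l. \<Prod>s\<in>UNIV. kernel (real l) 0 (d k $ s)))"
    (is "?lhs \<le> ?rhs")
proof -
  let ?P = "{..<l} \<times> (UNIV :: 't set)"
  define e where "e = (\<lambda>(k, s). d k $ s)"
  have prods: "(\<Prod>k<l. \<Prod>s\<in>UNIV. kernel (real l) v (d k $ s)) = (\<Prod>p\<in>?P. kernel (real l) v (e p))" for v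
    by (simp add: prod.cartesian_product e_def split_def)
  show ?thesis
  proof (cases "\<exists>p\<in>?P. e p = 0")
    case True
    \<comment> \<open>A vanishing increment makes the right side infinite, so the estimate is
      trivial in this case.\<close>
    have "(\<Prod>p\<in>?P. kernel (real l) u (e p)) = \<top>"
      unfolding ennreal_prod_eq_top
    proof (intro conjI ballI)
      show "kernel (real l) u (e p) \<noteq> 0" if "p \<in> ?P" for p
        using that d by (intro kernel_neq_0) (auto simp: e_def)
      show "\<exists>p\<in>?P. kernel (real l) u (e p) = \<top>"
        using True by (auto simp: kernel_def)
    qed auto
    then have "?rhs = \<top>"
      unfolding prods using c by (simp add: ennreal_mult_eq_top_iff)
    then show ?thesis by simp
  next
    case False
    then have pos: "0 < e p" if "p \<in> ?P" for p
    proof -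
      have "e p \<noteq> 0" "0 \<le> e p" using False that d by (auto simp: e_def split_def)
      then show ?thesis by simp
    qed
    define D where "D = (\<Prod>p\<in>?P. e p)"
    define S where "S = (\<Sum>p\<in>?P. e p)"
    define V where "V k = (\<Prod>s\<in>UNIV. d k $ s)" for k
    have D: "D = (\<Prod>k<l. V k)"
      by (simp add: D_def e_def V_def prod.cartesian_product split_def)
    have D_pos: "0 < D" unfolding D_def by (intro prod_pos) (use pos in auto)
    have V_nonneg: "0 \<le> V k" if "k < l" for k
      unfolding V_def using that d by (intro prod_nonneg) auto
    have "S = (\<Sum>s\<in>UNIV. \<Sum>k<l. d k $ s)"
      unfolding S_def e_def by (subst sum.swap) (simp add: sum.cartesian_product split_def)
    also have "\<dots> \<le> (\<Sum>s\<in>(UNIV::'t set). 1)" by (intro sum_mono sum_le)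
    finally have "S \<le> real CARD('t)" by simp
    \<comment> \<open>The increments sum to at most 1 in each coordinate, hence to at most
      \<open>CARD('t)\<close> altogether; the prefactor pays for the tilt.\<close>
    then have S: "1 \<le> exp (real l * real CARD('t)) * exp (- real l * S)"
      by (simp add: exp_add[symmetric] mult_left_mono)
    have "exp (- m * (\<Sum>k<l. V k)) \<le> c powr (u * real l) * D powr - u + exp (- m * real l * c)"
    proof (cases "D < c powr real l")
      case True
      have "exp (- m * (\<Sum>k<l. V k)) \<le> 1"
        using m V_nonneg by (auto intro!: mult_nonneg_nonneg sum_nonneg)
      also have "1 = D powr u * D powr - u" using D_pos by (simp add: powr_add[symmetric])
      also have "\<dots> \<le> (c powr real l) powr u * D powr - u"
        using True D_pos u by (intro mult_right_mono powr_mono2) auto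
      also have "\<dots> = c powr (u * real l) * D powr - u" by (simp add: powr_powr mult.commute)
      finally show ?thesis by (smt (verit) exp_gt_zero)
    next
      case False
      have "c = (c powr real l) powr (1 / real l)" using c l by (simp add: powr_powr)
      also have "\<dots> \<le> D powr (1 / real l)"
        using False c by (intro powr_mono2) auto
      also have "\<dots> \<le> (\<Sum>k<l. V k / real l)"
        unfolding D using arith_geom_mean[of "{..<l}" V] l V_nonneg by (auto simp: lessThan_empty_iff)
      finally have "real l * c \<le> (\<Sum>k<l. V k)"
        using l by (simp add: sum_divide_distrib[symmetric] field_simps)
      then have "m * (real l * c) \<le> m * (\<Sum>k<l. V k)" using m by (rule mult_left_mono)
      then have "exp (- m * (\<Sum>k<l. V k)) \<le> exp (- m * real l * c)"
        by (simp add: mult.assoc)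
      moreover have "0 \<le> c powr (u * real l) * D powr - u" by simp
      ultimately show ?thesis by linarith
    qed
    also have "\<dots> \<le> (exp (real l * real CARD('t)) * exp (- real l * S)) *
        (c powr (u * real l) * D powr - u + exp (- m * real l * c))"
      using mult_right_mono[OF S, of "c powr (u * real l) * D powr - u + exp (- m * real l * c)"]
      by simp
    \<comment> \<open>As \<open>D > 0\<close>, \<open>D powr - 0\<close> is 1; writing it out gives
      the second summand the shape of kernels with exponent 0.\<close>
    finally have *: "exp (- m * (\<Sum>k<l. V k)) \<le> exp (real l * real CARD('t)) *
        (c powr (u * real l) * (exp (- real l * S) * D powr - u) +
         exp (- m * real l * c) * (exp (- real l * S) * D powr - 0))"
      using D_pos by (simp add: algebra_simps)
    have prods': "(\<Prod>p\<in>?P. kernel (real l) v (e p)) = ennreal (exp (- real l * S) * D powr - v)" for v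
      unfolding S_def D_def by (rule prod_kernel_eq) (use pos in auto)
    show ?thesis
      unfolding prods prods' V_def[symmetric]
      using * by (simp add: ennreal_mult'[symmetric] ennreal_plus[symmetric] del: ennreal_plus)
  qed
qed

section \<open>Integrating out the increments of a chain\<close>

lemma chain_point_append:
  assumes "j \<notin> set is" "k \<le> length is"
  shows "chain_point (x(j := y)) (is @ [j]) k = chain_point x is k"
  using assms by (auto simp: chain_point_def nth_append)

lemma measurable_chain_point [measurable (raw)]:
  fixes N :: "(real ^ 't::finite) measure"
  assumes "k \<le> length is" "set is \<subseteq> I" "sets N = sets borel"
  shows "(\<lambda>x. chain_point x is k) \<in> borel_measurable (PiM I (\<lambda>_. N))"
proof (cases "k = 0")
  case False
  then have "is ! (k - 1) \<in> I" using assms nth_mem[of "k - 1" "is"] by auto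
  then have "(\<lambda>x. x (is ! (k - 1))) \<in> measurable (PiM I (\<lambda>_. N)) N"
    by (rule measurable_component_singleton)
  then show ?thesis using False assms(3) by (simp add: chain_point_def cong: measurable_cong_sets)
qed (simp add: chain_point_def)

text \<open>The increments of a chain are integrated out one point at a time, starting from the last.\<close>

lemma nn_integral_prod_increments_le:
  fixes N :: "(real ^ 't::finite) measure" and G :: "real ^ 't \<Rightarrow> ennreal"
  assumes "prob_space N" and sets: "sets N = sets borel"
    and le: "\<And>f. f \<in> borel_measurable borel \<Longrightarrow> (\<integral>\<^sup>+y. f y \<partial>N) \<le> (\<integral>\<^sup>+y. f y \<partial>lborel)"
    and G [measurable]: "G \<in> borel_measurable borel"
    and "distinct is"
  shows "(\<integral>\<^sup>+x. (\<Prod>k<length is. G (chain_point x is (Suc k) - chain_point x is k))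
      \<partial>PiM (set is) (\<lambda>_. N)) \<le> (\<integral>\<^sup>+y. G y \<partial>lborel) ^ length is"
  using \<open>distinct is\<close>
proof (induction "is" rule: rev_induct)
  case Nil
  interpret product_prob_space "\<lambda>_. N" "{} :: nat set"
    using assms(1) by (simp add: product_prob_spaceI)
  show ?case using P.emeasure_space_1 by simp
next
  case (snoc j "is")
  interpret product_prob_space "\<lambda>_. N" "set is"
    using assms(1) by (simp add: product_prob_spaceI)
  let ?J = "\<integral>\<^sup>+y. G y \<partial>lborel"
  let ?F = "\<lambda>x. \<Prod>k<length is. G (chain_point x is (Suc k) - chain_point x is k)"
  have j: "j \<notin> set is" "distinct is" using snoc.prems by auto
  \<comment> \<open>The last point occurs in the last factor only.\<close>
  have split: "(\<Prod>k<length (is @ [j]). G (chain_point (x(j := y)) (is @ [j]) (Suc k) -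
      chain_point (x(j := y)) (is @ [j]) k)) = ?F x * G (y - chain_point x is (length is))" for x y
  proof -
    have "chain_point (x(j := y)) (is @ [j]) (Suc (length is)) = y"
      by (simp add: chain_point_def)
    then show ?thesis using j by (simp add: chain_point_append)
  qed
  have m [measurable]: "(\<lambda>x. chain_point x is k) \<in> borel_measurable (PiM (set is) (\<lambda>_. N))"
    if "k \<le> length is" for k
    using that sets by (intro measurable_chain_point) auto
  have mF: "?F \<in> borel_measurable (PiM (set is) (\<lambda>_. N))"
    by (intro borel_measurable_prod_ennreal measurable_compose[OF _ G] borel_measurable_diff m) auto
  have "(\<integral>\<^sup>+x. (\<Prod>k<length (is @ [j]). G (chain_point x (is @ [j]) (Suc k) - chain_point x (is @ [j]) k))
      \<partial>PiM (set (is @ [j])) (\<lambda>_. N)) =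
    (\<integral>\<^sup>+x. (\<integral>\<^sup>+y. ?F x * G (y - chain_point x is (length is)) \<partial>N) \<partial>PiM (set is) (\<lambda>_. N))"
  proof -
    have "(\<lambda>x. \<Prod>k<length (is @ [j]). G (chain_point x (is @ [j]) (Suc k) - chain_point x (is @ [j]) k))
        \<in> borel_measurable (PiM (insert j (set is)) (\<lambda>_. N))"
      by (intro borel_measurable_prod_ennreal measurable_compose[OF _ G] borel_measurable_diff
          measurable_chain_point) (use sets in auto)
    from product_nn_integral_insert[OF _ j(1) this] show ?thesis
      unfolding split by simp
  qed
  also have "\<dots> \<le> (\<integral>\<^sup>+x. ?F x * ?J \<partial>PiM (set is) (\<lambda>_. N))"
  proof (rule nn_integral_mono)
    fix x
    have "(\<integral>\<^sup>+y. ?F x * G (y - chain_point x is (length is)) \<partial>N) =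
        ?F x * (\<integral>\<^sup>+y. G (y - chain_point x is (length is)) \<partial>N)"
      by (rule nn_integral_cmult) (simp add: sets cong: measurable_cong_sets)
    \<comment> \<open>Lebesgue measure is translation invariant, so after this step the preceding
      chain point drops out of the inner integral.\<close>
    also have "\<dots> \<le> ?F x * (\<integral>\<^sup>+y. G (y - chain_point x is (length is)) \<partial>lborel)"
      by (intro mult_left_mono le) auto
    also have "\<dots> = ?F x * ?J" by (simp add: nn_integral_lborel_shift)
    finally show "(\<integral>\<^sup>+y. ?F x * G (y - chain_point x is (length is)) \<partial>N) \<le> ?F x * ?J" .
  qed
  also have "\<dots> = (\<integral>\<^sup>+x. ?F x \<partial>PiM (set is) (\<lambda>_. N)) * ?J"
    by (rule nn_integral_multc[OF mF])
  also have "\<dots> \<le> ?J ^ length is * ?J"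
    using snoc.IH[OF j(2)] by (intro mult_right_mono) auto
  finally show ?case by (simp add: mult.commute)
qed

section \<open>The probability that the intervals of a chain are empty\<close>

definition unit_cube :: "(real ^ 't::finite) measure" where
  "unit_cube = uniform_measure lborel (cbox 0 1)"

lemma sets_unit_cube [simp, measurable_cong]: "sets unit_cube = sets borel"
  by (simp add: unit_cube_def)

lemma prob_space_unit_cube: "prob_space unit_cube"
  unfolding unit_cube_def by (rule prob_space_uniform_measure) (simp_all add: emeasure_lborel_unit_cube)

lemma nn_integral_unit_cube_le:
  assumes [measurable]: "f \<in> borel_measurable borel"
  shows "(\<integral>\<^sup>+y. f y \<partial>unit_cube) \<le> (\<integral>\<^sup>+y. f y \<partial>lborel)"
proof -
  have "(\<integral>\<^sup>+y. f y \<partial>unit_cube) = (\<integral>\<^sup>+y. f y * indicator (cbox 0 1) y \<partial>lborel)"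
    unfolding unit_cube_def
    by (subst nn_integral_uniform_measure)
      (simp_all add: emeasure_lborel_unit_cube divide_ennreal_def)
  also have "\<dots> \<le> (\<integral>\<^sup>+y. f y \<partial>lborel)"
    by (intro nn_integral_mono) (auto simp: indicator_def)
  finally show ?thesis .
qed

lemma AE_unit_cube: "AE y in unit_cube. y \<in> cbox 0 1"
  unfolding unit_cube_def by (rule AE_uniform_measureI) auto

lemma chain_point_mono:
  assumes "is_chain x n is" "\<And>i. i \<in> set is \<Longrightarrow> 0 \<le> x i" "j \<le> k" "k \<le> length is"
  shows "chain_point x is j \<le> chain_point x is k"
  using is_chain_nth(1)[OF assms(1), of "j - 1" "k - 1"] assms(2)[of "is ! (k - 1)"] assms(3,4)
  by (cases "j = 0"; cases "k = 0") (auto simp: chain_point_def)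

text \<open>The upper corner of an earlier box lies below the lower corner of a later one, so the
  open boxes are disjoint and their volumes add up. They lie in the cube, so these volumes are
  probabilities.\<close>

lemma emeasure_chain_boxes:
  fixes x :: "nat \<Rightarrow> real ^ 't::finite"
  assumes chain: "is_chain x n is" and cube: "\<And>i. i \<in> set is \<Longrightarrow> x i \<in> cbox 0 1"
  defines "R \<equiv> \<Union>k<length is. box (chain_point x is k) (chain_point x is (Suc k))"
  shows "emeasure unit_cube (- R) = ennreal (1 - (\<Sum>k<length is. \<Prod>s\<in>UNIV.
    (chain_point x is (Suc k) - chain_point x is k) $ s))"
proof -
  let ?B = "\<lambda>k. box (chain_point x is k) (chain_point x is (Suc k))"
  have nonneg: "0 \<le> x i" "x i \<le> 1" if "i \<in> set is" for i
    using cube[OF that] by (simp_all add: interval_cbox_cart[symmetric])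
  have cp01: "0 \<le> chain_point x is k \<and> chain_point x is k \<le> 1" if "k \<le> length is" for k
    using nonneg[of "is ! (k - 1)"] that by (cases "k = 0") (auto simp: chain_point_def less_eq_vec_def)
  have mono: "chain_point x is j \<le> chain_point x is k" if "j \<le> k" "k \<le> length is" for j k
    using chain_point_mono[OF chain] nonneg that by blast
  have disj: "disjoint_family_on ?B {..<length is}"
  proof -
    have "?B j \<inter> ?B k = {}" if "j < k" "k < length is" for j k
    proof -
      have "chain_point x is (Suc j) \<le> chain_point x is k" using that by (intro mono) auto
      then show ?thesis
        unfolding less_eq_vec_def disjoint_iff mem_box_cart by (meson less_asym order_less_le_trans)
    qed
    then show ?thesis
      unfolding disjoint_family_on_def by (metis Int_commute lessThan_iff linorder_neqE_nat)
  qed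
  have sub: "?B k \<subseteq> cbox 0 1" if "k < length is" for k
    using cp01[of k] cp01[of "Suc k"] that
    by (intro order.trans[OF box_subset_cbox]) (auto simp: interval_cbox_cart[symmetric] intro: order.trans)
  have V: "emeasure unit_cube (?B k) = ennreal (\<Prod>s\<in>UNIV.
      (chain_point x is (Suc k) - chain_point x is k) $ s)" if "k < length is" for k
  proof -
    have "cbox 0 1 \<inter> ?B k = ?B k" using sub[OF that] by auto
    then show ?thesis
      unfolding unit_cube_def using mono[of k "Suc k"] that
      by (subst emeasure_uniform_measure)
        (simp_all add: emeasure_lborel_unit_cube emeasure_lborel_box_vec divide_ennreal_def)
  qed
  have V_nonneg: "0 \<le> (\<Prod>s\<in>UNIV. (chain_point x is (Suc k) - chain_point x is k) $ s)"
    if "k < length is" for k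
    using mono[of k "Suc k"] that by (intro prod_nonneg) (auto simp: less_eq_vec_def)
  interpret U: prob_space "unit_cube :: (real ^ 't) measure" by (rule prob_space_unit_cube)
  have "emeasure unit_cube R = (\<Sum>k<length is. emeasure unit_cube (?B k))"
    unfolding R_def using disj by (intro sum_emeasure[symmetric]) auto
  also have "\<dots> = ennreal (\<Sum>k<length is. \<Prod>s\<in>UNIV.
      (chain_point x is (Suc k) - chain_point x is k) $ s)"
    using V_nonneg by (subst sum_ennreal[symmetric]) (auto simp: V)
  finally have "U.prob R = (\<Sum>k<length is. \<Prod>s\<in>UNIV.
      (chain_point x is (Suc k) - chain_point x is k) $ s)"
    using V_nonneg by (auto simp: measure_def intro!: enn2real_ennreal sum_nonneg)
  moreover have "R \<in> sets borel" unfolding R_def by auto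
  moreover have "space (unit_cube :: (real ^ 't) measure) = UNIV"
    using sets_eq_imp_space_eq[OF sets_unit_cube] by simp
  ultimately show ?thesis
    using U.prob_compl[of R] by (simp add: U.emeasure_eq_measure Compl_eq_Diff_UNIV)
qed

text \<open>Given the chain points, maximality keeps each of the \<open>n - length is\<close> other
  points out of the boxes. These points are independent, and 1 - V \<le> exp (- V) for the total
  volume V.\<close>

lemma nn_integral_maximal_chain_le:
  fixes x :: "nat \<Rightarrow> real ^ 't::finite"
  assumes sub: "set is \<subseteq> {1..n}" and dist: "distinct is"
    and cube: "\<And>i. i \<in> set is \<Longrightarrow> x i \<in> cbox 0 1"
  defines "J \<equiv> {1..n} - set is"
  shows "(\<integral>\<^sup>+y. indicator {z. is_maximal_chain z n is} (merge (set is) J (x, y)) \<partial>PiM J (\<lambda>_. unit_cube))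
    \<le> (if is_chain x n is then ennreal (exp (- real (n - length is) * (\<Sum>k<length is. \<Prod>s\<in>UNIV.
        (chain_point x is (Suc k) - chain_point x is k) $ s))) else 0)"
proof (cases "is_chain x n is")
  case False
  \<comment> \<open>Whether the list is a chain depends on the coordinates \<open>x\<close>
    alone.\<close>
  have "\<not> is_maximal_chain (merge (set is) J (x, y)) n is" for y
  proof -
    have *: "map (merge (set is) J (x, y)) is = map x is" by (simp add: merge_def)
    have "is_chain (merge (set is) J (x, y)) n is = is_chain x n is"
      unfolding is_chain_def * by (rule refl)
    with False show ?thesis by (simp add: is_maximal_chain_def)
  qed
  then show ?thesis using False by simp
next
  case True
  let ?B = "\<lambda>k. box (chain_point x is k) (chain_point x is (Suc k))"
  define R where "R = (\<Union>k<length is. ?B k)"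
  define V where "V = (\<Sum>k<length is. \<Prod>s\<in>UNIV. (chain_point x is (Suc k) - chain_point x is k) $ s)"
  interpret product_prob_space "\<lambda>_. unit_cube :: (real ^ 't) measure" J
    by (simp add: product_prob_spaceI prob_space_unit_cube)
  have R [measurable]: "R \<in> sets borel" unfolding R_def by auto
  \<comment> \<open>A point of the open box differs from both corners and lies between them, so it
    belongs to the corresponding interval.\<close>
  have "indicator {z. is_maximal_chain z n is} (merge (set is) J (x, y)) \<le>
      (\<Prod>j\<in>J. indicator (- R) (y j) :: ennreal)" for y
  proof (cases "\<exists>j\<in>J. y j \<in> R")
    case True
    then obtain j k where jk: "j \<in> J" "k < length is" "y j \<in> ?B k" by (auto simp: R_def)
    let ?z = "merge (set is) J (x, y)"
    have z: "?z (is ! k) = x (is ! k)" if "k < length is" for k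
      using that by (simp add: merge_def)
    have cp: "chain_point ?z is k = chain_point x is k" using jk by (auto simp: chain_point_def z)
    have zj: "?z j = y j" using jk by (simp add: merge_def J_def)
    have "chain_point x is k \<le> y j" "y j \<le> x (is ! k)"
      using jk(3) by (auto simp: mem_box_cart less_eq_vec_def chain_point_Suc[OF jk(2)] intro: less_imp_le)
    moreover have "y j \<noteq> chain_point x is k" "y j \<noteq> x (is ! k)"
      using jk(3) by (auto simp: mem_box_cart chain_point_Suc[OF jk(2)])
    ultimately have "\<not> is_maximal_chain ?z n is"
      unfolding is_maximal_chain_iff using jk(1,2) cp z zj J_def by metis
    then show ?thesis by simp
  next
    case False
    then have "(\<Prod>j\<in>J. indicator (- R) (y j) :: ennreal) = 1" by (intro prod.neutral) auto
    then show ?thesis by (simp add: indicator_def)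
  qed
  then have "(\<integral>\<^sup>+y. indicator {z. is_maximal_chain z n is} (merge (set is) J (x, y)) \<partial>PiM J (\<lambda>_. unit_cube))
      \<le> (\<integral>\<^sup>+y. (\<Prod>j\<in>J. indicator (- R) (y j)) \<partial>PiM J (\<lambda>_. unit_cube))"
    by (intro nn_integral_mono) auto
  also have "\<dots> = (\<Prod>j\<in>J. \<integral>\<^sup>+y. indicator (- R) y \<partial>unit_cube)"
    by (rule product_nn_integral_prod) (auto simp: J_def)
  also have "\<dots> = ennreal (1 - V) ^ card J"
  proof -
    have "(\<integral>\<^sup>+y. indicator (- R) y \<partial>unit_cube) = emeasure unit_cube (- R)"
      using R by (intro nn_integral_indicator) auto
    also have "\<dots> = ennreal (1 - V)"
      unfolding R_def V_def by (rule emeasure_chain_boxes[OF True cube])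
    finally show ?thesis by simp
  qed
  also have "\<dots> \<le> ennreal (exp (- V)) ^ card J"
    using exp_ge_add_one_self[of "- V"] by (intro power_mono ennreal_leI) auto
  also have "card J = n - length is"
    unfolding J_def using sub dist by (simp add: card_Diff_subset distinct_card)
  also have "ennreal (exp (- V)) ^ (n - length is) = ennreal (exp (- real (n - length is) * V))"
    by (simp add: ennreal_power exp_of_nat_mult[symmetric])
  finally show ?thesis using True by (simp add: V_def)
qed

text \<open>Fubini separates the chain points from the rest: the inner integral is the void
  probability, which is dominated by kernels, and these are integrated increment by increment. The
  bound depends on the list only through its length.\<close>

lemma emeasure_maximal_chain_le:
  fixes l :: nat and c u :: real
  assumes sub: "set is \<subseteq> {1..n}" and dist: "distinct is" and l: "length is = l" "0 < l"
    and c: "0 < c" and u: "0 \<le> u" "u < 1"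
  shows "(\<integral>\<^sup>+x. indicator {z. is_maximal_chain z n is} x
      \<partial>PiM {1..n} (\<lambda>_. unit_cube :: (real ^ 't::finite) measure)) \<le>
    ennreal (exp (real l * real CARD('t)) *
      (c powr (u * real l) * (Gamma (1 - u) * real l powr (u - 1)) ^ (CARD('t) * l) +
       exp (- real (n - l) * real l * c) * (1 / real l) ^ (CARD('t) * l)))"
proof -
  let ?U = "unit_cube :: (real ^ 't) measure"
  define J where "J = {1..n} - set is"
  define K where "K v x = (\<Prod>k<l. \<Prod>s\<in>UNIV.
    kernel (real l) v ((chain_point x is (Suc k) - chain_point x is k) $ s))" for v and x :: "nat \<Rightarrow> real ^ 't"
  define A where "A = ennreal (exp (real l * real CARD('t)))"
  define B0 where "B0 = ennreal (c powr (u * real l))"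
  define B1 where "B1 = ennreal (exp (- real (n - l) * real l * c))"
  interpret product_prob_space "\<lambda>_. ?U" "{1..n}"
    by (simp add: product_prob_spaceI prob_space_unit_cube)
  have un: "set is \<union> J = {1..n}" using sub by (auto simp: J_def)
  have m: "(\<lambda>x. indicator {z. is_maximal_chain z n is} x :: ennreal) \<in> borel_measurable (PiM (set is \<union> J) (\<lambda>_. ?U))"
    unfolding un
  proof (intro borel_measurable_indicator')
    have "Measurable.pred (PiM {1..n} (\<lambda>_. ?U)) (\<lambda>x. is_maximal_chain (\<lambda>i. x i) n is)"
      by (rule measurable_is_maximal_chain) measurable
    then show "{x \<in> space (PiM {1..n} (\<lambda>_. ?U)). x \<in> {z. is_maximal_chain z n is}} \<in> sets (PiM {1..n} (\<lambda>_. ?U))"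
      by (simp add: pred_def)
  qed
  have mG: "(\<lambda>y. \<Prod>s\<in>UNIV. kernel (real l) v (y $ s)) \<in> borel_measurable (borel :: (real ^ 't) measure)" for v
    by measurable
  have mK [measurable]: "K v \<in> borel_measurable (PiM (set is) (\<lambda>_. ?U))" for v
    unfolding K_def
    by (intro borel_measurable_prod_ennreal[where S = "{..<l}"] measurable_compose[OF _ mG] borel_measurable_diff
        measurable_chain_point) (use l in auto)
  have intK: "(\<integral>\<^sup>+x. K v x \<partial>PiM (set is) (\<lambda>_. ?U)) \<le>
      ennreal ((Gamma (1 - v) * real l powr (v - 1)) ^ (CARD('t) * l))" if "v < 1" for v
    using nn_integral_prod_increments_le[OF prob_space_unit_cube sets_unit_cube
        nn_integral_unit_cube_le mG[of v] dist] nn_integral_kernel_vec[of "real l" v, where 't = 't] that l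
    by (simp add: K_def ennreal_power power_mult)
  have "(\<integral>\<^sup>+x. indicator {z. is_maximal_chain z n is} x \<partial>PiM {1..n} (\<lambda>_. ?U)) =
      (\<integral>\<^sup>+x. (\<integral>\<^sup>+y. indicator {z. is_maximal_chain z n is} (merge (set is) J (x, y))
         \<partial>PiM J (\<lambda>_. ?U)) \<partial>PiM (set is) (\<lambda>_. ?U))"
    using product_nn_integral_fold[OF _ _ _ m] unfolding un by (simp add: J_def)
  also have "\<dots> \<le> (\<integral>\<^sup>+x. A * (B0 * K u x + B1 * K 0 x) \<partial>PiM (set is) (\<lambda>_. ?U))"
  proof (rule nn_integral_mono_AE)
    \<comment> \<open>The product space contains all of \<real>^t, so membership in the cube holds
      only almost everywhere; it bounds the increments.\<close>
    have "AE x in PiM (set is) (\<lambda>_. ?U). \<forall>i\<in>set is. x i \<in> cbox 0 1"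
      by (intro AE_finite_allI AE_PiM_component prob_space_unit_cube AE_unit_cube) auto
    then show "AE x in PiM (set is) (\<lambda>_. ?U).
      (\<integral>\<^sup>+y. indicator {z. is_maximal_chain z n is} (merge (set is) J (x, y)) \<partial>PiM J (\<lambda>_. ?U))
      \<le> A * (B0 * K u x + B1 * K 0 x)"
    proof eventually_elim
      case (elim x)
      let ?d = "\<lambda>k. chain_point x is (Suc k) - chain_point x is k"
      have "(\<integral>\<^sup>+y. indicator {z. is_maximal_chain z n is} (merge (set is) J (x, y)) \<partial>PiM J (\<lambda>_. ?U))
        \<le> (if is_chain x n is then
            ennreal (exp (- real (n - l) * (\<Sum>k<l. \<Prod>s\<in>UNIV. ?d k $ s))) else 0)"
        using nn_integral_maximal_chain_le[OF sub dist bspec[OF elim]] unfolding J_def l(1) .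
      also have "\<dots> \<le> A * (B0 * K u x + B1 * K 0 x)"
      proof (cases "is_chain x n is")
        case True
        have nonneg: "0 \<le> x i" "x i \<le> 1" if "i \<in> set is" for i
          using elim that by (auto simp: interval_cbox_cart[symmetric])
        have "ennreal (exp (- real (n - l) * (\<Sum>k<l. \<Prod>s\<in>UNIV. ?d k $ s))) \<le>
            A * (B0 * K u x + B1 * K 0 x)"
          unfolding A_def B0_def B1_def K_def
        proof (rule void_probability_le_kernels)
          show "0 \<le> ?d k $ s" if "k < l" for k s
            using chain_point_mono[OF True nonneg(1), of k "Suc k"] that l
            by (simp add: less_eq_vec_def)
          show "(\<Sum>k<l. ?d k $ s) \<le> 1" for s
          proof -
            have "(\<Sum>k<l. ?d k $ s) = (\<Sum>k<l. chain_point x is (Suc k) $ s - chain_point x is k $ s)"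
              by simp
            also have "\<dots> = chain_point x is l $ s - chain_point x is 0 $ s"
              by (rule sum_lessThan_telescope)
            also have "\<dots> = x (is ! (l - 1)) $ s"
              using l by (simp add: chain_point_def)
            also have "\<dots> \<le> 1"
              using nonneg(2)[of "is ! (l - 1)"] l by (auto simp: less_eq_vec_def)
            finally show ?thesis .
          qed
        qed (use l c u in auto)
        then show ?thesis using True by simp
      qed simp
      finally show ?case .
    qed
  qed
  also have "\<dots> = A * (B0 * (\<integral>\<^sup>+x. K u x \<partial>PiM (set is) (\<lambda>_. ?U)) +
      B1 * (\<integral>\<^sup>+x. K 0 x \<partial>PiM (set is) (\<lambda>_. ?U)))"
    by (simp add: nn_integral_cmult nn_integral_add)
  also have "\<dots> \<le> A * (B0 * ennreal ((Gamma (1 - u) * real l powr (u - 1)) ^ (CARD('t) * l)) +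
      B1 * ennreal ((Gamma (1 - 0) * real l powr (0 - 1)) ^ (CARD('t) * l)))"
    using u by (intro mult_left_mono add_mono intK) auto
  also have "Gamma (1 - 0) * real l powr (0 - 1) = 1 / real l"
    using l by (simp add: powr_minus_divide)
  also have "A * (B0 * ennreal ((Gamma (1 - u) * real l powr (u - 1)) ^ (CARD('t) * l)) +
      B1 * ennreal ((1 / real l) ^ (CARD('t) * l))) =
    ennreal (exp (real l * real CARD('t)) *
      (c powr (u * real l) * (Gamma (1 - u) * real l powr (u - 1)) ^ (CARD('t) * l) +
       exp (- real (n - l) * real l * c) * (1 / real l) ^ (CARD('t) * l)))"
    using u unfolding A_def B0_def B1_def
    by (simp add: ennreal_mult'[symmetric] ennreal_plus[symmetric] del: ennreal_plus)
  finally show ?thesis .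
qed

section \<open>The first moment\<close>

text \<open>Independence makes the joint law of the sample a product of uniform laws, and the event
  depends on the sample only.\<close>

lemma emeasure_maximal_chain_eq:
  fixes X :: "nat \<Rightarrow> 'a \<Rightarrow> real ^ 't::finite"
  assumes iid: "iid_uniform_cube M X n" and n: "0 < n"
  shows "emeasure M {\<omega> \<in> space M. is_maximal_chain (\<lambda>i. X i \<omega>) n is} =
    (\<integral>\<^sup>+x. indicator {z. is_maximal_chain z n is} x \<partial>PiM {1..n} (\<lambda>_. unit_cube :: (real ^ 't) measure))"
proof -
  interpret prob_space M using iid by (simp add: iid_uniform_cube_def)
  have indep: "indep_vars (\<lambda>_. borel) X {1..n}"
    and distr: "\<And>i. i \<in> {1..n} \<Longrightarrow> distr M borel (X i) = unit_cube"
    using iid by (auto simp: iid_uniform_cube_def unit_cube_def)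
  have X: "X i \<in> borel_measurable M" if "i \<in> {1..n}" for i
    using indep that unfolding indep_vars_def by auto
  let ?X = "\<lambda>\<omega>. \<lambda>i\<in>{1..n}. X i \<omega>"
  let ?P = "PiM {1..n} (\<lambda>_. borel :: (real ^ 't) measure)"
  \<comment> \<open>The characterisation of independence by the joint law asks for a nonempty index
    set, which \<open>0 < n\<close> provides.\<close>
  have "distr M ?P ?X = PiM {1..n} (\<lambda>i. distr M borel (X i))"
    using indep X n by (subst (asm) indep_vars_iff_distr_eq_PiM') auto
  also have "\<dots> = PiM {1..n} (\<lambda>_. unit_cube)"
    by (intro PiM_cong refl distr)
  finally have D: "PiM {1..n} (\<lambda>_. unit_cube) = distr M ?P ?X" ..
  have A: "{\<omega> \<in> space M. is_maximal_chain (\<lambda>i. X i \<omega>) n is} \<in> sets M"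
    using measurable_is_maximal_chain[of n X M] X by (simp add: pred_def)
  have "Measurable.pred ?P (\<lambda>x. is_maximal_chain (\<lambda>i. x i) n is)"
    by (rule measurable_is_maximal_chain) measurable
  then have m: "(\<lambda>x. indicator {z. is_maximal_chain z n is} x :: ennreal) \<in> borel_measurable ?P"
    by (intro borel_measurable_indicator') (simp add: pred_def)
  have "(\<integral>\<^sup>+x. indicator {z. is_maximal_chain z n is} x \<partial>PiM {1..n} (\<lambda>_. unit_cube :: (real ^ 't) measure)) =
      (\<integral>\<^sup>+\<omega>. indicator {z. is_maximal_chain z n is} (?X \<omega>) \<partial>M)"
    unfolding D by (intro nn_integral_distr measurable_restrict X) (use m in simp_all)
  also have "\<dots> = (\<integral>\<^sup>+\<omega>. indicator {\<omega> \<in> space M. is_maximal_chain (\<lambda>i. X i \<omega>) n is} \<omega> \<partial>M)"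
  proof (rule nn_integral_cong)
    fix \<omega> assume "\<omega> \<in> space M"
    moreover have "is_maximal_chain (?X \<omega>) n is = is_maximal_chain (\<lambda>i. X i \<omega>) n is"
      by (rule is_maximal_chain_cong) simp
    ultimately show "(indicator {z. is_maximal_chain z n is} (?X \<omega>) :: ennreal) =
        indicator {\<omega> \<in> space M. is_maximal_chain (\<lambda>i. X i \<omega>) n is} \<omega>"
      by (simp add: indicator_def)
  qed
  finally show ?thesis using A by simp
qed

text \<open>Linearity of expectation over the \<open>n ^ l\<close> index lists; a list with
  repetitions is never a chain and contributes 0.\<close>

lemma expectation_num_maximal_chains:
  fixes X :: "nat \<Rightarrow> 'a \<Rightarrow> real ^ 't::finite"
  assumes iid: "iid_uniform_cube M X n"
  shows "integrable M (\<lambda>\<omega>. real (num_maximal_chains (\<lambda>i. X i \<omega>) n l))"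
    and "(\<And>is. set is \<subseteq> {1..n} \<Longrightarrow> distinct is \<Longrightarrow> length is = l \<Longrightarrow>
        measure M {\<omega> \<in> space M. is_maximal_chain (\<lambda>i. X i \<omega>) n is} \<le> B) \<Longrightarrow> 0 \<le> B \<Longrightarrow>
      prob_space.expectation M (\<lambda>\<omega>. real (num_maximal_chains (\<lambda>i. X i \<omega>) n l)) \<le> real n ^ l * B"
proof -
  interpret prob_space M using iid by (simp add: iid_uniform_cube_def)
  let ?L = "{is. set is \<subseteq> {1..n} \<and> length is = l}"
  let ?A = "\<lambda>is. {\<omega> \<in> space M. is_maximal_chain (\<lambda>i. X i \<omega>) n is}"
  have L: "finite ?L" "card ?L = n ^ l"
    by (simp_all add: finite_lists_length_eq card_lists_length_eq)
  have X: "X i \<in> borel_measurable M" if "i \<in> {1..n}" for i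
    using iid that unfolding iid_uniform_cube_def indep_vars_def by auto
  have A: "?A is \<in> events" for "is"
    using measurable_is_maximal_chain[of n X M] X by (simp add: pred_def)
  have eq: "real (num_maximal_chains (\<lambda>i. X i \<omega>) n l) = (\<Sum>is\<in>?L. indicator (?A is) \<omega>)"
    if "\<omega> \<in> space M" for \<omega>
  proof -
    have "{is. is_maximal_chain (\<lambda>i. X i \<omega>) n is \<and> length is = l} =
        {is \<in> ?L. is_maximal_chain (\<lambda>i. X i \<omega>) n is}"
      by (auto simp: is_maximal_chain_def is_chain_def)
    then have "real (num_maximal_chains (\<lambda>i. X i \<omega>) n l) =
        (\<Sum>is\<in>?L. if is_maximal_chain (\<lambda>i. X i \<omega>) n is then 1 else 0)"
      unfolding num_maximal_chains_def using L(1) by (simp add: sum.If_cases Int_def)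
    also have "\<dots> = (\<Sum>is\<in>?L. indicator (?A is) \<omega>)"
      using that by (intro sum.cong) (auto simp: indicator_def)
    finally show ?thesis .
  qed
  have ind: "integrable M (indicator (?A is) :: 'a \<Rightarrow> real)" for "is"
    using A by (intro integrable_real_indicator) (auto simp: emeasure_eq_measure)
  have "integrable M (\<lambda>\<omega>. \<Sum>is\<in>?L. indicator (?A is) \<omega> :: real)"
    using ind by (intro Bochner_Integration.integrable_sum) auto
  then show "integrable M (\<lambda>\<omega>. real (num_maximal_chains (\<lambda>i. X i \<omega>) n l))"
    using eq by (subst Bochner_Integration.integrable_cong[OF refl]) auto
  assume B: "\<And>is. set is \<subseteq> {1..n} \<Longrightarrow> distinct is \<Longrightarrow> length is = l \<Longrightarrow> prob (?A is) \<le> B" "0 \<le> B"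
  have prob_le: "prob (?A is) \<le> B" if "is \<in> ?L" for "is"
  proof (cases "distinct is")
    case False
    then have *: "?A is = {}" by (auto simp: is_maximal_chain_def dest: is_chain_distinct)
    show ?thesis unfolding * using B(2) by simp
  qed (use B that in auto)
  have "expectation (\<lambda>\<omega>. real (num_maximal_chains (\<lambda>i. X i \<omega>) n l)) =
      expectation (\<lambda>\<omega>. \<Sum>is\<in>?L. indicator (?A is) \<omega>)"
    using eq by (intro Bochner_Integration.integral_cong) auto
  also have "\<dots> = (\<Sum>is\<in>?L. expectation (indicator (?A is)))"
    using ind by (intro Bochner_Integration.integral_sum) auto
  also have "\<dots> = (\<Sum>is\<in>?L. prob (?A is))"
    using A by (intro sum.cong refl) simp
  also have "\<dots> \<le> (\<Sum>is\<in>?L. B)" by (intro sum_mono prob_le)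
  also have "\<dots> = real n ^ l * B" using L by simp
  finally show "expectation (\<lambda>\<omega>. real (num_maximal_chains (\<lambda>i. X i \<omega>) n l)) \<le> real n ^ l * B" .
qed

text \<open>The scale \<open>exp (- a) / l ^ t\<close> is chosen so that all powers of
  \<open>l\<close> involving \<open>u\<close> cancel. Writing \<open>l = exp L\<close> reduces the
  claim to comparing exponents.\<close>

lemma kernel_constant_eq:
  fixes l t :: nat
  assumes l: "0 < l"
  shows "(exp (- a) / real l ^ t) powr (u * real l) * (G * real l powr (u - 1)) ^ (t * l) =
    (1 / real l) ^ (t * l) * (G ^ t / exp (a * u)) ^ l"
proof -
  define L where "L = ln (real l)"
  have el: "real l = exp L" using l by (simp add: L_def)
  have 1: "(exp (- a) / real l ^ t) powr (u * real l) = exp (u * real l * (- a - real t * L))"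
    unfolding el by (simp add: powr_def exp_of_nat_mult[symmetric] exp_diff[symmetric])
  have 2: "(G * real l powr (u - 1)) ^ (t * l) = G ^ (t * l) * exp (real t * real l * ((u - 1) * L))"
    using l by (simp add: powr_def L_def power_mult_distrib exp_of_nat_mult[symmetric])
  have 3: "(1 / real l) ^ (t * l) = exp (- (real t * real l * L))"
    using exp_of_nat_mult[of "t * l" "- L"] l by (simp add: L_def exp_minus divide_inverse)
  have 4: "(G ^ t / exp (a * u)) ^ l = G ^ (t * l) * exp (- (real l * (a * u)))"
    by (simp add: power_mult_distrib power_inverse power_mult exp_of_nat_mult exp_minus divide_inverse)
  show ?thesis
    unfolding 1 2 3 4
    by (simp add: mult.left_commute mult.commute exp_add[symmetric] algebra_simps)
qed

lemma expectation_num_maximal_chains_le: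
  fixes X :: "nat \<Rightarrow> 'a \<Rightarrow> real ^ 't::finite"
  assumes iid: "iid_uniform_cube M X n" and l: "0 < l" and n: "0 < n" and u: "0 \<le> u" "u < 1"
  shows "prob_space.expectation M (\<lambda>\<omega>. real (num_maximal_chains (\<lambda>i. X i \<omega>) n l)) \<le>
    (exp 1 ^ CARD('t) * (real n / real l ^ CARD('t))) ^ l *
      (gamma_quot CARD('t) a u ^ l + exp (- real (n - l) * real l * (exp (- a) / real l ^ CARD('t))))"
proof -
  define c where "c = exp (- a) / real l ^ CARD('t)"
  define B where "B = exp (real l * real CARD('t)) *
      (c powr (u * real l) * (Gamma (1 - u) * real l powr (u - 1)) ^ (CARD('t) * l) +
       exp (- real (n - l) * real l * c) * (1 / real l) ^ (CARD('t) * l))"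
  interpret prob_space M using iid by (simp add: iid_uniform_cube_def)
  have c: "0 < c" using l by (simp add: c_def)
  have B: "0 \<le> B" using u by (simp add: B_def Gamma_real_nonneg)
  have "prob {\<omega> \<in> space M. is_maximal_chain (\<lambda>i. X i \<omega>) n is} \<le> B"
    if "set is \<subseteq> {1..n}" "distinct is" "length is = l" for "is"
    using emeasure_maximal_chain_le[OF that l c u, where 't = 't] B
    unfolding emeasure_maximal_chain_eq[OF iid n, symmetric] B_def[symmetric]
    by (simp add: emeasure_eq_measure)
  then have "expectation (\<lambda>\<omega>. real (num_maximal_chains (\<lambda>i. X i \<omega>) n l)) \<le> real n ^ l * B"
    by (intro expectation_num_maximal_chains(2)[OF iid] B)
  also have "B = exp (real l * real CARD('t)) * (1 / real l) ^ (CARD('t) * l) *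
      (gamma_quot CARD('t) a u ^ l + exp (- real (n - l) * real l * c))"
    unfolding B_def c_def kernel_constant_eq[OF l] gamma_quot_def by (simp add: algebra_simps)
  also have "exp (real l * real CARD('t)) = (exp 1 ^ CARD('t)) ^ l"
    by (simp add: exp_of_nat_mult[symmetric] power_mult[symmetric] mult.commute)
  finally show ?thesis
    unfolding power_mult by (simp add: c_def power_mult_distrib power_divide mult_ac)
qed

section \<open>Exponential decay above the threshold\<close>

text \<open>Follows from 1 - y \<le> exp (- y) with y = k (s' - s). It permits replacing n / l^t by
  its upper bound 1 / x^t although the exponential factor may decrease.\<close>

lemma mult_exp_neg_mono:
  fixes k s s' :: real
  assumes "0 < s" "s \<le> s'" "k * s' \<le> 1"
  shows "s * exp (- k * s) \<le> s' * exp (- k * s')"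
proof -
  have "s / s' = 1 - (s' - s) / s'" using assms by (simp add: field_simps)
  also have "\<dots> \<le> 1 - k * (s' - s)"
  proof -
    have "k * (s' - s) \<le> (1 / s') * (s' - s)"
      using assms by (intro mult_right_mono) (auto simp: field_simps)
    then show ?thesis by simp
  qed
  also have "\<dots> \<le> exp (- (k * (s' - s)))"
    using exp_ge_add_one_self[of "- (k * (s' - s))"] by simp
  finally have "s \<le> s' * exp (- (k * (s' - s)))" using assms by (simp add: field_simps)
  then have "s * exp (- k * s) \<le> (s' * exp (- (k * (s' - s)))) * exp (- k * s)"
    by (intro mult_right_mono) auto
  also have "\<dots> = s' * exp (- k * s')" by (simp add: exp_add[symmetric] algebra_simps)
  finally show ?thesis .
qed

text \<open>The first summand is monotone in n / l^t, which \<open>w\<close> bounds by 1 / x^t. In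
  the second, \<open>void\<close> trades \<open>n - l\<close> for n / (1 + b)^t before
  \<open>mult_exp_neg_mono\<close> applies.\<close>

lemma first_moment_bound_le:
  fixes l n t :: nat
  assumes l: "0 < l" and n: "0 < n" and x: "0 < x" and b: "0 < b" and u: "u < 1"
    and w: "x ^ t * real n \<le> real l ^ t"
    and void: "1 / (1 + b) ^ t \<le> 1 - real l / real n"
    and a: "exp (- a) \<le> x ^ t"
  shows "(exp 1 ^ t * (real n / real l ^ t)) ^ l *
      (gamma_quot t a u ^ l + exp (- real (n - l) * real l * (exp (- a) / real l ^ t)))
    \<le> ((exp 1 / x) ^ t * gamma_quot t a u) ^ l + ((exp 1 / x) ^ t * void_bound t x a b) ^ l"
proof -
  define s where "s = real n / real l ^ t"
  define k where "k = exp (- a) / (1 + b) ^ t"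
  have s: "0 < s" "s \<le> 1 / x ^ t"
    using l n w x by (auto simp: s_def field_simps)
  have e: "exp 1 ^ t * (1 / x ^ t) = (exp 1 / x) ^ t" by (simp add: power_divide)
  have gq: "0 \<le> gamma_quot t a u" using gamma_quot_pos[OF u] by (simp add: less_imp_le)
  have b1: "1 \<le> (1 + b) ^ t" using b by simp
  have "(exp 1 ^ t * s) ^ l * gamma_quot t a u ^ l = (exp 1 ^ t * s * gamma_quot t a u) ^ l"
    by (simp add: power_mult_distrib)
  also have "\<dots> \<le> ((exp 1 / x) ^ t * gamma_quot t a u) ^ l"
    unfolding e[symmetric] using s gq by (intro power_mono mult_right_mono mult_left_mono) auto
  finally have 1: "(exp 1 ^ t * s) ^ l * gamma_quot t a u ^ l \<le> ((exp 1 / x) ^ t * gamma_quot t a u) ^ l" .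
  have "real (n - l) * real l * (exp (- a) / real l ^ t) \<ge> real l * (k * s)"
  proof -
    have "real n * (1 / (1 + b) ^ t) \<le> real n * (1 - real l / real n)"
      using void by (rule mult_left_mono) simp
    \<comment> \<open>Subtraction of naturals truncates at 0, hence an inequality.\<close>
    also have "\<dots> \<le> real (n - l)" using n by (simp add: algebra_simps)
    finally have "real n * (1 / (1 + b) ^ t) * (real l * (exp (- a) / real l ^ t)) \<le>
        real (n - l) * (real l * (exp (- a) / real l ^ t))"
      by (rule mult_right_mono) simp
    then show ?thesis by (simp add: k_def s_def mult_ac)
  qed
  then have "exp (- real (n - l) * real l * (exp (- a) / real l ^ t)) \<le> exp (- k * s) ^ l"
    by (simp add: exp_of_nat_mult[symmetric])
  then have "(exp 1 ^ t * s) ^ l * exp (- real (n - l) * real l * (exp (- a) / real l ^ t)) \<le>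
      (exp 1 ^ t * s) ^ l * exp (- k * s) ^ l"
    using s by (intro mult_left_mono) auto
  also have "\<dots> = (exp 1 ^ t * (s * exp (- k * s))) ^ l"
    by (simp add: power_mult_distrib mult.assoc)
  also have "\<dots> \<le> (exp 1 ^ t * (1 / x ^ t * exp (- k * (1 / x ^ t)))) ^ l"
  proof (intro power_mono mult_left_mono mult_exp_neg_mono s)
    \<comment> \<open>Together with \<open>a\<close> this places 1 / x^t in the range where
      \<open>mult_exp_neg_mono\<close> applies.\<close>
    have "k \<le> exp (- a)" unfolding k_def using b1 by (simp add: divide_le_eq mult_le_cancel_left1)
    then show "k * (1 / x ^ t) \<le> 1" using a x by simp
  qed (use s in auto)
  also have "exp 1 ^ t * (1 / x ^ t * exp (- k * (1 / x ^ t))) = (exp 1 / x) ^ t * void_bound t x a b"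
    unfolding e[symmetric] void_bound_def k_def by (simp add: mult.commute)
  finally have 2: "(exp 1 ^ t * s) ^ l * exp (- real (n - l) * real l * (exp (- a) / real l ^ t)) \<le>
      ((exp 1 / x) ^ t * void_bound t x a b) ^ l" .
  show ?thesis using add_mono[OF 1 2] unfolding s_def by (simp add: distrib_left)
qed

text \<open>A point \<open>x\<close> strictly below \<open>x_bar + \<epsilon>\<close> makes both
  bases less than 1, and eventually \<open>l n\<close> exceeds x n^(1/t). The rate is fixed before
  the samples and lengths, so it is uniform in them.\<close>

lemma expectation_num_maximal_chains_bigo:
  assumes t: "2 \<le> CARD('t::finite)" and \<epsilon>: "0 < \<epsilon>"
  obtains \<theta> :: real where "0 < \<theta>"
    "\<And>(M :: nat \<Rightarrow> 'a measure) (X :: nat \<Rightarrow> nat \<Rightarrow> 'a \<Rightarrow> real ^ 't) (l :: nat \<Rightarrow> nat).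
       (\<And>n. iid_uniform_cube (M n) (X n) n) \<Longrightarrow>
       (\<And>n. \<bar>real (l n) - (x_bar CARD('t) + \<epsilon>) * real n powr (1 / real CARD('t))\<bar> < 1) \<Longrightarrow>
       (\<lambda>n. prob_space.expectation (M n)
              (\<lambda>\<omega>. real (num_maximal_chains (\<lambda>i. X n i \<omega>) n (l n))))
         \<in> O(\<lambda>n. exp (- \<theta> * real n powr (1 / real CARD('t))))"
proof -
  let ?t = "CARD('t)"
  have t0: "0 < ?t" using t by simp
  define y where "y = x_bar ?t + \<epsilon>"
  obtain x a b u where w: "0 < x" "x < y" "0 < b" "u \<in> {0<..<1}" "exp (- a) \<le> x ^ ?t"
    "(exp 1 / x) ^ ?t * gamma_quot ?t a u < 1" "(exp 1 / x) ^ ?t * void_bound ?t x a b < 1"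
    using x_bar_witness[OF t0 \<epsilon>] unfolding y_def by metis
  define \<rho> where "\<rho> = max ((exp 1 / x) ^ ?t * gamma_quot ?t a u) ((exp 1 / x) ^ ?t * void_bound ?t x a b)"
  have r0: "0 < (exp 1 / x) ^ ?t * gamma_quot ?t a u" "0 < (exp 1 / x) ^ ?t * void_bound ?t x a b"
    using w gamma_quot_pos[of u ?t a] void_bound_bounds[of x b ?t a] by auto
  then have \<rho>: "0 < \<rho>" "\<rho> < 1" using w by (auto simp: \<rho>_def)
  \<comment> \<open>Chosen so that
    \<open>\<rho> powr (x * N n) = exp (- \<theta> * N n)\<close>.\<close>
  define \<theta> where "\<theta> = - x * ln \<rho>"
  have "0 < \<theta>" using \<rho> w by (simp add: \<theta>_def mult_pos_neg)
  then show ?thesis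
  proof (rule that)
    fix M :: "nat \<Rightarrow> 'a measure" and X :: "nat \<Rightarrow> nat \<Rightarrow> 'a \<Rightarrow> real ^ 't" and l :: "nat \<Rightarrow> nat"
    assume iid: "\<And>n. iid_uniform_cube (M n) (X n) n"
      and l': "\<And>n. \<bar>real (l n) - (x_bar ?t + \<epsilon>) * real n powr (1 / real ?t)\<bar> < 1"
    define N where "N n = real n powr (1 / real ?t)" for n :: nat
    have l: "y * N n - 1 < real (l n)" "real (l n) < y * N n + 1" for n
      using l'[of n] by (auto simp: N_def y_def abs_less_iff)
    have t2: "1 / real ?t < 1" using t by simp
    have "filterlim N at_top sequentially"
      unfolding N_def using t0 by real_asymp
    \<comment> \<open>Once (y - x) n^(1/t) is at least 1, it absorbs the rounding error of
      \<open>l n\<close>.\<close>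
    then have ev1: "eventually (\<lambda>n. 1 / (y - x) \<le> N n) sequentially"
      by (auto simp: filterlim_at_top)
    \<comment> \<open>For \<open>t \<ge> 2\<close> chain lengths are negligible against
      \<open>n\<close>, so the loss from \<open>n\<close> to \<open>n - l n\<close> fits into the
      slack given by \<open>b > 0\<close>.\<close>
    have "((\<lambda>n. (y * N n + 1) / real n) \<longlongrightarrow> 0) sequentially"
      unfolding N_def using t2 by real_asymp
    moreover have "0 < 1 - 1 / (1 + b) ^ ?t"
      using w(3) t0 by (simp add: one_less_power)
    ultimately have ev2: "eventually (\<lambda>n. (y * N n + 1) / real n < 1 - 1 / (1 + b) ^ ?t) sequentially"
      by (auto simp: order_tendsto_iff)
    have "eventually (\<lambda>n. norm (prob_space.expectation (M n)
              (\<lambda>\<omega>. real (num_maximal_chains (\<lambda>i. X n i \<omega>) n (l n)))) \<le>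
            2 * norm (exp (- \<theta> * N n))) sequentially"
      using ev1 ev2 eventually_gt_at_top[of 0]
    proof eventually_elim
      case (elim n)
      interpret prob_space "M n" using iid[of n] by (simp add: iid_uniform_cube_def)
      let ?E = "expectation (\<lambda>\<omega>. real (num_maximal_chains (\<lambda>i. X n i \<omega>) n (l n)))"
      have N: "0 < N n" using elim(3) by (simp add: N_def)
      have "1 \<le> (y - x) * N n" using elim(1) w by (simp add: field_simps)
      then have lx: "x * N n < real (l n)" using l(1)[of n] by (simp add: algebra_simps)
      then have l0: "0 < l n" using w N by (smt (verit) mult_pos_pos of_nat_0_less_iff)
      have "(x * N n) ^ ?t \<le> real (l n) ^ ?t" using lx w N by (intro power_mono) auto
      moreover have "N n ^ ?t = real n"
        using elim(3) t0 by (simp add: N_def powr_power)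
      ultimately have 1: "x ^ ?t * real n \<le> real (l n) ^ ?t" by (simp add: power_mult_distrib)
      have "real (l n) / real n \<le> (y * N n + 1) / real n"
        using l(2)[of n] by (intro divide_right_mono) auto
      then have 2: "1 / (1 + b) ^ ?t \<le> 1 - real (l n) / real n" using elim(2) by simp
      have "?E \<le> (exp 1 ^ ?t * (real n / real (l n) ^ ?t)) ^ l n *
          (gamma_quot ?t a u ^ l n + exp (- real (n - l n) * real (l n) * (exp (- a) / real (l n) ^ ?t)))"
        using w by (intro expectation_num_maximal_chains_le iid l0 elim) auto
      also have "\<dots> \<le> ((exp 1 / x) ^ ?t * gamma_quot ?t a u) ^ l n +
          ((exp 1 / x) ^ ?t * void_bound ?t x a b) ^ l n"
        using w by (intro first_moment_bound_le l0 elim 1 2) auto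
      also have "\<dots> \<le> \<rho> ^ l n + \<rho> ^ l n"
        using r0 by (intro add_mono power_mono) (auto simp: \<rho>_def)
      also have "\<rho> ^ l n = \<rho> powr real (l n)" using \<rho> by (simp add: powr_realpow)
      also have "\<dots> \<le> \<rho> powr (x * N n)"
        using \<rho> lx by (intro powr_mono') auto
      also have "\<dots> = exp (- \<theta> * N n)" using \<rho> by (simp add: powr_def \<theta>_def mult_ac)
      finally have "?E \<le> 2 * exp (- \<theta> * N n)" by simp
      moreover have "0 \<le> ?E" by (intro Bochner_Integration.integral_nonneg) auto
      ultimately show ?case by simp
    qed
    then show "(\<lambda>n. prob_space.expectation (M n)
              (\<lambda>\<omega>. real (num_maximal_chains (\<lambda>i. X n i \<omega>) n (l n))))
         \<in> O(\<lambda>n. exp (- \<theta> * real n powr (1 / real ?t)))"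
      unfolding N_def by (rule bigoI)
  qed
qed

section \<open>From the first moment to the longest chain\<close>

text \<open>An integer length is at least \<open>z\<close> iff it is at least the ceiling of
  \<open>z\<close>, that is, iff a maximal chain of that length exists; Markov's inequality bounds
  the probability of this.\<close>

lemma prob_longest_chain_less:
  fixes X :: "nat \<Rightarrow> 'a \<Rightarrow> real ^ 't::finite"
  assumes iid: "iid_uniform_cube M X n" and z: "0 \<le> z"
  shows "1 - prob_space.expectation M (\<lambda>\<omega>. real (num_maximal_chains (\<lambda>i. X i \<omega>) n (nat \<lceil>z\<rceil>)))
    \<le> measure M {\<omega> \<in> space M. real (longest_chain_length (\<lambda>i. X i \<omega>) n) < z}"
proof -
  interpret prob_space M using iid by (simp add: iid_uniform_cube_def)
  let ?f = "\<lambda>\<omega>. real (num_maximal_chains (\<lambda>i. X i \<omega>) n (nat \<lceil>z\<rceil>))"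
  have int: "integrable M ?f" by (rule expectation_num_maximal_chains(1)[OF iid])
  then have [measurable]: "?f \<in> borel_measurable M" by auto
  let ?A = "{\<omega> \<in> space M. 0 < ?f \<omega>}"
  have A: "?A \<in> events" by measurable
  have "{\<omega> \<in> space M. real (longest_chain_length (\<lambda>i. X i \<omega>) n) < z} = space M - ?A"
    using z by (auto simp: num_maximal_chains_pos_iff not_less ceiling_le_iff nat_le_iff)
  then have "prob {\<omega> \<in> space M. real (longest_chain_length (\<lambda>i. X i \<omega>) n) < z} = 1 - prob ?A"
    using prob_compl[OF A] by simp
  moreover have "prob ?A \<le> expectation ?f"
  proof -
    have "prob ?A = expectation (indicator ?A)" using A by simp
    also have "\<dots> \<le> expectation ?f"
      using A int by (intro integral_mono integrable_real_indicator)
        (auto simp: indicator_def emeasure_eq_measure)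
    finally show ?thesis .
  qed
  ultimately show ?thesis by simp
qed

theorem theorem1:
  assumes "CARD('t::finite) \<ge> 3"
  shows
    "(\<forall>x>0.
        (\<forall>a b. (a, b) \<in> ab_domain CARD('t) \<longrightarrow>
           (\<exists>u. is_arg_min (gamma_quot CARD('t) a) (\<lambda>u. u \<in> {0<..<1}) u) \<and>
           q_ab CARD('t) x a b < 1) \<and>
        (\<exists>!p. is_arg_min (\<lambda>(a, b). q_ab CARD('t) x a b) (\<lambda>p. p \<in> ab_domain CARD('t)) p) \<and>
        (\<forall>a b. is_arg_min (\<lambda>(a, b). q_ab CARD('t) x a b) (\<lambda>p. p \<in> ab_domain CARD('t)) (a, b) \<longrightarrow>
           q_min CARD('t) x = q_ab CARD('t) x a b \<and>
           gamma_quot_min CARD('t) a = (1 + b) / exp b \<and>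
           (1 + b) / exp b = exp (- (exp (- a) / (x ^ CARD('t) * (1 + b) ^ CARD('t)))))) \<and>
     x_bar CARD('t) < exp 1 \<and>
     (\<forall>\<epsilon>>0. \<exists>c1 c2 \<theta>. 0 < c1 \<and> (\<forall>n. c1 \<le> \<theta> n \<and> \<theta> n \<le> c2) \<and>
        (\<forall>(M :: nat \<Rightarrow> 'a measure) (X :: nat \<Rightarrow> nat \<Rightarrow> 'a \<Rightarrow> real ^ 't) (l :: nat \<Rightarrow> nat).
           (\<forall>n. iid_uniform_cube (M n) (X n) n) \<longrightarrow>
           (\<forall>n. \<bar>real (l n) - (x_bar CARD('t) + \<epsilon>) * real n powr (1 / real CARD('t))\<bar> < 1) \<longrightarrow>
           (\<forall>n. integrable (M n) (\<lambda>\<omega>. real (num_maximal_chains (\<lambda>i. X n i \<omega>) n (l n)))) \<and>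
           (\<lambda>n. prob_space.expectation (M n)
                  (\<lambda>\<omega>. real (num_maximal_chains (\<lambda>i. X n i \<omega>) n (l n))))
             \<in> O(\<lambda>n. exp (- \<theta> n * real n powr (1 / real CARD('t)))))) \<and>
     (\<forall>\<epsilon>>0. \<exists>c1 c2 \<theta>. 0 < c1 \<and> (\<forall>n. c1 \<le> \<theta> n \<and> \<theta> n \<le> c2) \<and>
        (\<forall>(M :: nat \<Rightarrow> 'a measure) (X :: nat \<Rightarrow> nat \<Rightarrow> 'a \<Rightarrow> real ^ 't).
           (\<forall>n. iid_uniform_cube (M n) (X n) n) \<longrightarrow>
           (\<exists>r. r \<in> O(\<lambda>n. exp (- \<theta> n * real n powr (1 / real CARD('t)))) \<and>
              (\<forall>n. prob_space.prob (M n)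
                     {\<omega> \<in> space (M n). real (longest_chain_length (\<lambda>i. X n i \<omega>) n)
                        < (x_bar CARD('t) + \<epsilon>) * real n powr (1 / real CARD('t))}
                   \<ge> 1 - r n))))"
proof -
  let ?t = "CARD('t)"
  have t: "0 < ?t" "2 \<le> ?t" using assms by auto
  have "(\<forall>a b. (a, b) \<in> ab_domain ?t \<longrightarrow>
           (\<exists>u. is_arg_min (gamma_quot ?t a) (\<lambda>u. u \<in> {0<..<1}) u) \<and> q_ab ?t x a b < 1) \<and>
        (\<exists>!p. is_arg_min (\<lambda>(a, b). q_ab ?t x a b) (\<lambda>p. p \<in> ab_domain ?t) p) \<and>
        (\<forall>a b. is_arg_min (\<lambda>(a, b). q_ab ?t x a b) (\<lambda>p. p \<in> ab_domain ?t) (a, b) \<longrightarrow>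
           q_min ?t x = q_ab ?t x a b \<and>
           gamma_quot_min ?t a = (1 + b) / exp b \<and>
           (1 + b) / exp b = exp (- (exp (- a) / (x ^ ?t * (1 + b) ^ ?t))))"
    if x: "0 < x" for x :: real
  proof (intro conjI allI impI)
    fix a b assume ab: "(a, b) \<in> ab_domain ?t"
    then have "a > euler_mascheroni * real ?t" by (simp add: ab_domain_def)
    from gamma_quot_attains_min[OF t(1) this] obtain u where "u \<in> {0<..<1}"
      "\<And>v. v \<in> {0<..<1} \<Longrightarrow> gamma_quot ?t a u \<le> gamma_quot ?t a v" by metis
    then show "\<exists>u. is_arg_min (gamma_quot ?t a) (\<lambda>u. u \<in> {0<..<1}) u"
      unfolding is_arg_min_def by (meson linorder_not_less)
    show "q_ab ?t x a b < 1" by (rule q_ab_bounds(2)[OF t(1) x ab])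
  next
    show "\<exists>!p. is_arg_min (\<lambda>(a, b). q_ab ?t x a b) (\<lambda>p. p \<in> ab_domain ?t) p"
      by (rule minimal_q_ab(1)[OF t(1) x])
  qed (use minimal_q_ab(2)[OF t(1) x, unfolded chernoff_def void_bound_def] in blast)+
  moreover have "x_bar ?t < exp 1" by (rule x_bar_less[OF t(1)])
  moreover have "\<exists>c1 c2 \<theta>. 0 < c1 \<and> (\<forall>n. c1 \<le> \<theta> n \<and> \<theta> n \<le> c2) \<and>
        (\<forall>(M :: nat \<Rightarrow> 'a measure) (X :: nat \<Rightarrow> nat \<Rightarrow> 'a \<Rightarrow> real ^ 't) (l :: nat \<Rightarrow> nat).
           (\<forall>n. iid_uniform_cube (M n) (X n) n) \<longrightarrow>
           (\<forall>n. \<bar>real (l n) - (x_bar ?t + \<epsilon>) * real n powr (1 / real ?t)\<bar> < 1) \<longrightarrow>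
           (\<forall>n. integrable (M n) (\<lambda>\<omega>. real (num_maximal_chains (\<lambda>i. X n i \<omega>) n (l n)))) \<and>
           (\<lambda>n. prob_space.expectation (M n)
                  (\<lambda>\<omega>. real (num_maximal_chains (\<lambda>i. X n i \<omega>) n (l n))))
             \<in> O(\<lambda>n. exp (- \<theta> n * real n powr (1 / real ?t))))"
    if \<epsilon>: "0 < \<epsilon>" for \<epsilon> :: real
  \<comment> \<open>The rate is constant in \<open>n\<close>, so one number serves as both bounds
    and as the sequence.\<close>
  proof (rule expectation_num_maximal_chains_bigo[OF t(2) \<epsilon>, where 'a = 'a], goal_cases)
    case (1 \<theta>)
    then show ?case
      by (intro exI[of _ \<theta>] exI[of _ "\<lambda>_. \<theta>"]) (auto intro: expectation_num_maximal_chains(1))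
  qed
  moreover have "\<exists>c1 c2 \<theta>. 0 < c1 \<and> (\<forall>n. c1 \<le> \<theta> n \<and> \<theta> n \<le> c2) \<and>
        (\<forall>(M :: nat \<Rightarrow> 'a measure) (X :: nat \<Rightarrow> nat \<Rightarrow> 'a \<Rightarrow> real ^ 't).
           (\<forall>n. iid_uniform_cube (M n) (X n) n) \<longrightarrow>
           (\<exists>r. r \<in> O(\<lambda>n. exp (- \<theta> n * real n powr (1 / real ?t))) \<and>
              (\<forall>n. prob_space.prob (M n)
                     {\<omega> \<in> space (M n). real (longest_chain_length (\<lambda>i. X n i \<omega>) n)
                        < (x_bar ?t + \<epsilon>) * real n powr (1 / real ?t)}
                   \<ge> 1 - r n)))"
    if \<epsilon>: "0 < \<epsilon>" for \<epsilon> :: real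
  proof (rule expectation_num_maximal_chains_bigo[OF t(2) \<epsilon>, where 'a = 'a], goal_cases)
    case (1 \<theta>)
    define z where "z n = (x_bar ?t + \<epsilon>) * real n powr (1 / real ?t)" for n
    \<comment> \<open>The witness is a positive number below
      \<open>x_bar ?t + \<epsilon>\<close>.\<close>
    have "0 \<le> x_bar ?t + \<epsilon>" using x_bar_witness[OF t(1) \<epsilon>] by (smt (verit))
    then have z: "0 \<le> z n" for n by (simp add: z_def)
    have l: "\<bar>real (nat \<lceil>z n\<rceil>) - z n\<bar> < 1" for n
      using z[of n] by linarith
    show ?case
    proof (rule exI[of _ \<theta>], rule exI[of _ \<theta>], rule exI[of _ "\<lambda>_. \<theta>"], intro conjI allI impI)
      fix M :: "nat \<Rightarrow> 'a measure" and X :: "nat \<Rightarrow> nat \<Rightarrow> 'a \<Rightarrow> real ^ 't"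
      assume iid: "\<forall>n. iid_uniform_cube (M n) (X n) n"
      \<comment> \<open>The error term is the expected number of maximal chains of the rounded-up
        length, which is within 1 of \<open>z n\<close>.\<close>
      let ?r = "\<lambda>n. prob_space.expectation (M n)
        (\<lambda>\<omega>. real (num_maximal_chains (\<lambda>i. X n i \<omega>) n (nat \<lceil>z n\<rceil>)))"
      have "?r \<in> O(\<lambda>n. exp (- \<theta> * real n powr (1 / real ?t)))"
        by (rule 1(2)) (use iid l in \<open>auto simp: z_def\<close>)
      moreover have "1 - ?r n \<le> prob_space.prob (M n) {\<omega> \<in> space (M n).
          real (longest_chain_length (\<lambda>i. X n i \<omega>) n) < (x_bar ?t + \<epsilon>) * real n powr (1 / real ?t)}" for n
        using prob_longest_chain_less[OF spec[OF iid] z] unfolding z_def .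
      ultimately show "\<exists>r. r \<in> O(\<lambda>n. exp (- \<theta> * real n powr (1 / real ?t))) \<and>
          (\<forall>n. prob_space.prob (M n) {\<omega> \<in> space (M n).
            real (longest_chain_length (\<lambda>i. X n i \<omega>) n) < (x_bar ?t + \<epsilon>) * real n powr (1 / real ?t)}
            \<ge> 1 - r n)"
        by blast
    qed (use 1 in auto)
  qed
  ultimately show ?thesis by blast
qed

end
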